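(* Consider the exact variance-reduced zeroth-order scheme (ZSOL$^{1s}_{ncvx}$, exact) described in the context for $\min_{x\in\mathcal X}f^{\rm imp}(x)$ ($f^{\rm imp}$ possibly nonconvex), under Assumptions (A1)--(A3), (U') of the context. Then the following hold. (a) For any $\gamma<\frac{\eta}{nL_0}$, with $\ell:=\lceil\lambda K\rceil$, and all $K>\frac2{1-\lambda}$, $$\mathbb E\big[\|G_{\eta,1/\gamma}(x_R)\|^2\big]\le\frac{n^2L_0^2\gamma(0.5-\ln\lambda)\Big(1-\frac{nL_0\gamma}{2\eta}\Big)+\mathbb E[f^{\rm imp}(x_\ell)]-f^*+2L_0\eta}{\Big(1-\frac{nL_0\gamma}{\eta}\Big)\frac\gamma4(1-\lambda)K}.$$ (b) Suppose $\gamma=\frac{\eta}{2nL_0}$ and $\eta=\frac1{L_0}$. Let $\epsilon>0$ and let $K_\epsilon$ be such that $\mathbb E[\|G_{\eta,1/\gamma}(x_R)\|^2]\le\epsilon$. Then: (b-1) the total number of upper-level projection steps on $\mathcal X$ is $K_\epsilon=\mathcal O(n^2L_0^2\epsilon^{-1})$; (b-2) the total sample complexity of the upper level is $\mathcal O(n^4L_0^4\epsilon^{-2})$.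
   Context: Notation. $\mathbb B$ and $\mathbb S$ are the Euclidean unit ball and unit sphere of $\mathbb R^n$; $\Pi_C$ is Euclidean projection onto $C$; $\mathcal O(\cdot)$ hides factors not depending on $\epsilon,n,L_0$. Problem. $\mathcal X\subseteq\mathbb R^n$, $\mathcal Y\subseteq\mathbb R^m$; $\omega$ is a random variable on a probability space $(\Omega,\mathcal F,\mathbb P)$; $\tilde f(x,y,\omega)\in\mathbb R$, $G(x,y,\omega)\in\mathbb R^m$, $F(x,y)=\mathbb E[G(x,y,\omega)]$. For each $x$, $y(x)$ is the unique solution of VI$(\mathcal Y,F(x,\cdot))$: $y\in\mathcal Y$ and $(\tilde y-y)^TF(x,y)\ge0$ for all $\tilde y\in\mathcal Y$. The implicit problem is $\min_{x\in\mathcal X}f^{\rm imp}(x):=\mathbb E[\tilde f(x,y(x),\omega)]$, with optimal value $f^*$. For $\eta>0$, $f^{\rm imp}_\eta(x):=\mathbb E_u[f^{\rm imp}(x+\eta u)]$, $u$ uniform on $\mathbb B$. The residual mapping is $G_{\eta,\beta}(x):=\beta\big(x-\Pi_{\mathcal X}[x-\frac1\beta\nabla_xf^{\rm imp}_\eta(x)]\big)$. Assumptions. (A1) For some $\eta_0>0$ and every $\omega$, $x\mapsto\tilde f(x,y(x),\omega)$ is $L_0(\omega)$-Lipschitz on $\mathcal X+\eta_0\mathbb B$ with $L_0:=\sqrt{\mathbb E[L_0^2(\omega)]}<\infty$; and $\tilde f(x,\cdot,\omega)$ is $\tilde L_0(\omega)$-Lipschitz for all $x\in\mathcal X+\eta_0\mathbb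 B$, with $\tilde L_0:=\sqrt{\mathbb E[\tilde L_0^2(\omega)]}<\infty$. The smoothing parameter satisfies $0<\eta\le\eta_0$. (A2) $\mathcal X,\mathcal Y$ are nonempty, closed, bounded, convex. (A3) $F(x,\cdot)$ is $\mu_F$-strongly monotone and $L_F$-Lipschitz on $\mathcal Y$, uniformly in $x\in\mathcal X+\eta_0\mathbb B$. (U') At iteration $k$, $v_{1,k},\dots,v_{N_k,k}$ are iid uniformly distributed on $\eta\mathbb S$ and $\omega_{1,k},\dots,\omega_{N_k,k}$ are iid replicates of $\omega$, independent of the $v_{j,k}$. Scheme (ZSOL$^{1s}_{ncvx}$, exact). Given $x_0\in\mathcal X$, stepsize $\gamma>0$, $\eta>0$, $N_k=k+1$, an integer $K$, $\lambda\in(0,1)$, and $R$ drawn uniformly at random from $\{\lceil\lambda K\rceil,\dots,K\}$. For each $k$, with exact values $y(x_k)$ and $y(x_k+v_{j,k})$, set $$g_{j,k}=\frac{n\big(\tilde f(x_k+v_{j,k},y(x_k+v_{j,k}),\omega_{j,k})-\tilde f(x_k,y(x_k),\omega_{j,k})\big)v_{j,k}}{\|v_{j,k}\|\eta},\quad x_{k+1}=\Pi_{\mathcal X}\Big[x_k-\gamma\tfrac1{N_k}\sum_{j=1}^{N_k}g_{j,k}\Big].$$ The output is $x_R$. *)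

theory Defs
  imports "HOL-Probability.Probability"
begin

definition is_VI_sol :: "'b::real_inner set \<Rightarrow> ('b \<Rightarrow> 'b) \<Rightarrow> 'b \<Rightarrow> bool" where
  "is_VI_sol Y F y \<longleftrightarrow> y \<in> Y \<and> (\<forall>z\<in>Y. (z - y) \<bullet> F y \<ge> 0)"

definition VI_sol :: "'b::real_inner set \<Rightarrow> ('b \<Rightarrow> 'b) \<Rightarrow> 'b" where
  "VI_sol Y F = (THE y. is_VI_sol Y F y)"

definition strongly_monotone_on :: "real \<Rightarrow> 'b::real_inner set \<Rightarrow> ('b \<Rightarrow> 'b) \<Rightarrow> bool" where
  "strongly_monotone_on \<mu> Y F \<longleftrightarrow>
     0 < \<mu> \<and> (\<forall>y\<in>Y. \<forall>z\<in>Y. \<mu> * (norm (y - z))\<^sup>2 \<le> (F y - F z) \<bullet> (y - z))"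

text \<open>
  The expectation of \<open>h (x + \<eta> u)\<close> for \<open>u\<close> uniform on the closed unit ball. It is written as a set
  integral so that only the values of \<open>h\<close> on \<open>cball x \<eta>\<close> matter, including for measurability.
\<close>
definition smoothing :: "real \<Rightarrow> (real ^ 'n \<Rightarrow> real) \<Rightarrow> real ^ 'n \<Rightarrow> real" where
  "smoothing \<eta> h x =
     (LINT u:cball 0 1|lborel. h (x + \<eta> *\<^sub>R u)) / measure lborel (cball (0 :: real ^ 'n) 1)"

text \<open>
  The gradient of \<open>h\<close> at \<open>x\<close> relative to a set \<open>S\<close>. At interior points of \<open>S\<close> it is the ordinary
  gradient. It may fail to be unique if \<open>S\<close> has empty interior, hence the choice operator.
\<close>
definition grad_within :: "'a::real_inner set \<Rightarrow> ('a \<Rightarrow> real) \<Rightarrow> 'a \<Rightarrow> 'a" where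
  "grad_within S h x = (SOME g. (h has_derivative (\<lambda>d. g \<bullet> d)) (at x within S))"

text \<open>
  The residual mapping of the smoothed function. The function \<open>h\<close> is only controlled on
  \<open>X + cball 0 \<eta>0\<close>, so \<open>smoothing \<eta> h\<close> is only controlled on \<open>X + cball 0 (\<eta>0 - \<eta>)\<close>, and its
  gradient is taken relative to that set. For \<open>\<eta> < \<eta>0\<close> this set is a neighbourhood of every point of
  \<open>X\<close> and the gradient is the usual one. For \<open>\<eta> = \<eta>0\<close> the set is \<open>X\<close> itself; different choices
  of the gradient then differ by a vector orthogonal to the affine hull of \<open>X\<close>, which does not
  change the projection onto \<open>X\<close>, so the residual is well defined in this case too.
\<close>
definition residual ::
  "(real ^ 'n) set \<Rightarrow> real \<Rightarrow> (real ^ 'n \<Rightarrow> real) \<Rightarrow> real \<Rightarrow> real \<Rightarrow> real ^ 'n \<Rightarrow> real ^ 'n" where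
  "residual X \<eta>0 h \<eta> \<beta> x =
     \<beta> *\<^sub>R (x - closest_point X
       (x - (1 / \<beta>) *\<^sub>R grad_within (X + cball 0 (\<eta>0 - \<eta>)) (smoothing \<eta> h) x))"

text \<open>
  The uniform distribution on the sphere of radius \<open>r\<close> about the origin, that is, normalised surface
  measure, obtained as the law of \<open>r u / norm u\<close> with \<open>u\<close> uniform on the unit ball.
\<close>
definition uniform_sphere :: "real \<Rightarrow> (real ^ 'n) measure" where
  "uniform_sphere r = distr (uniform_measure lborel (cball 0 1)) borel (\<lambda>u. (r / norm u) *\<^sub>R u)"

text \<open>
  Independence of two random variables whose values may have different types (the two variables of
  \<open>indep_var\<close> are forced to share one value type).
\<close>
definition indep_rv ::
  "'s measure \<Rightarrow> 'a measure \<Rightarrow> ('s \<Rightarrow> 'a) \<Rightarrow> 'b measure \<Rightarrow> ('s \<Rightarrow> 'b) \<Rightarrow> bool" where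
  "indep_rv P A X B Y \<longleftrightarrow> X \<in> P \<rightarrow>\<^sub>M A \<and> Y \<in> P \<rightarrow>\<^sub>M B \<and>
     distr P (A \<Otimes>\<^sub>M B) (\<lambda>s. (X s, Y s)) = distr P A X \<Otimes>\<^sub>M distr P B Y"

definition batch_size :: "nat \<Rightarrow> nat" where
  "batch_size k = k + 1"

text \<open>Index pairs \<open>(k, j)\<close> of the samples: sample \<open>j\<close> of iteration \<open>k\<close>.\<close>
definition sample_index :: "(nat \<times> nat) set" where
  "sample_index = (SIGMA k:UNIV. {1..batch_size k})"

text \<open>Here \<open>h x w\<close> stands for the sampled objective at \<open>x\<close> with the exact lower-level solution.\<close>
definition zo_gradient ::
  "(real ^ 'n \<Rightarrow> 'w \<Rightarrow> real) \<Rightarrow> real \<Rightarrow> real ^ 'n \<Rightarrow> real ^ 'n \<Rightarrow> 'w \<Rightarrow> real ^ 'n" where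
  "zo_gradient h \<eta> x v w =
     (real CARD('n) * (h (x + v) w - h x w) / (norm v * \<eta>)) *\<^sub>R v"

text \<open>Number of upper-level samples consumed by the first \<open>K\<close> projection steps.\<close>
definition sample_count :: "nat \<Rightarrow> nat" where
  "sample_count K = (\<Sum>k<K. batch_size k)"

text \<open>
  The factor hidden in the complexity estimates: it depends only on \<open>lam\<close> and on a bound \<open>\<Delta>\<close> for the
  optimality gap over the feasible set. It is given explicitly since the dimension is a type, so that
  an existentially quantified constant could silently depend on the dimension. It arises from the
  error bound at \<open>\<gamma> = \<eta> / (2 n L0)\<close>, \<open>\<eta> = 1 / L0\<close>; the summand 1 accounts for rounding up.
\<close>
definition hidden_factor :: "real \<Rightarrow> real \<Rightarrow> real" where
  "hidden_factor lam \<Delta> = 16 / (1 - lam) * (3 / 8 * (1 / 2 - ln lam) + \<Delta> + 2) + 1"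

end

theory Submission
  imports Defs
begin

text \<open>
  For an \<open>L\<close>-Lipschitz function on \<open>\<real>\<^sup>n\<close>, the average over the ball of radius \<open>\<eta>\<close> is within \<open>L \<eta>\<close> of the
  function and has a gradient given by an average over the sphere, which is \<open>n L / \<eta>\<close>-Lipschitz.
  Hence each zeroth-order sample is an unbiased estimate of the gradient of the smoothed objective,
  with second moment at most \<open>n\<^sup>2 L\<^sup>2\<close>, and samples of one batch have orthogonal errors given the
  current iterate, so a batch of size \<open>k + 1\<close> has mean square error at most \<open>n\<^sup>2 L\<^sup>2 / (k + 1)\<close>.
  The descent lemma for a projected inexact gradient step, summed over the last \<open>(1 - \<lambda>) K\<close> steps,
  telescopes; the errors contribute the tail \<open>\<Sum> 1 / (k + 1) \<le> 1/2 - ln \<lambda>\<close> of the harmonic series, and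
  a uniformly random index turns the sum into the expected residual.
\<close>

section \<open>Differentiating ball averages of Lipschitz functions\<close>

text \<open>A Lipschitz integrand need not have a gradient at every point, so the ball average is
  differentiated through its kernel: the increment is shifted from the integrand onto a Lipschitz
  cutoff of the ball. The dimension factor then appears as the derivative of \<open>r ^ n\<close> at
  1, the growth rate of the volume of a shell.

  Two domain problems shape the rest. The objective is controlled near \<open>X\<close> only, so the
  analysis is done for a globally Lipschitz extension, and it has to be checked that neither the
  iterates nor the residual can see the difference. If \<eta> = \<eta>0, the gradient in the
  residual is taken relative to \<open>X\<close> itself and may be ambiguous; projecting onto
  \<open>X\<close> removes the ambiguity.

  Conditional expectations are avoided: the recursion is a deterministic function of a table of
  samples, and one entry of the table is integrated out by Fubini while the others are frozen.

  The complexity bound is obtained from a witness found by rounding up. A bound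
  \<open>n^2 L0^2\<close> on the squared residual, valid on all of \<open>X\<close>, covers the case
  of large \<epsilon>, where rounding would spoil the estimate.\<close>

lemma integrable_bounded_support:
  fixes f :: "'a::euclidean_space \<Rightarrow> real"
  assumes "f \<in> borel_measurable borel" "\<And>u. norm u \<le> R \<Longrightarrow> \<bar>f u\<bar> \<le> B" "\<And>u. R < norm u \<Longrightarrow> f u = 0"
  shows "integrable lborel f"
proof (rule Bochner_Integration.integrable_bound)
  have "integrable lborel (indicat_real (cball (0::'a) R))"
    using emeasure_bounded_finite[OF bounded_cball, of "0::'a" R] by (intro integrable_real_indicator) auto
  then show "integrable lborel (\<lambda>u. B * indicat_real (cball (0::'a) R) u)"
    by simp
  show "AE u in lborel. norm (f u) \<le> norm (B * indicat_real (cball 0 R) u)"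
    using assms(2,3) by (intro AE_I2) (force simp: indicator_def not_le)
qed (use assms(1) in simp)

lemma continuous_bounded_on_cball:
  fixes F :: "'a::euclidean_space \<Rightarrow> real"
  assumes "continuous_on UNIV F"
  obtains B where "0 \<le> B" "\<And>u. norm u \<le> R \<Longrightarrow> \<bar>F (x + u)\<bar> \<le> B"
proof -
  have "compact ((\<lambda>u. F (x + u)) ` cball 0 R)"
    by (intro compact_continuous_image continuous_on_compose2[OF assms] continuous_intros) auto
  then obtain B where B: "\<And>y. y \<in> (\<lambda>u. F (x + u)) ` cball 0 R \<Longrightarrow> norm y \<le> B"
    using compact_imp_bounded bounded_iff by metis
  show ?thesis
  proof (rule that[of "max 0 B"])
    show "\<bar>F (x + u)\<bar> \<le> max 0 B" if "norm u \<le> R" for u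
      using B[of "F (x + u)"] that by (auto simp: le_max_iff_disj)
  qed auto
qed

text \<open>\<open>F\<close> is only continuous, so the derivative has to fall on the kernel: by
  translation invariance \<open>F (x + h + u) * k u\<close> has the same integral as
  \<open>F (x + u) * k (u - h)\<close>. Moving \<open>k\<close> backwards produces the minus sign.
  The difference quotients of \<open>k\<close> are bounded by its Lipschitz constant, so dominated
  convergence gets by with differentiability almost everywhere.\<close>

lemma has_derivative_kernel_average:
  fixes F k :: "'a::euclidean_space \<Rightarrow> real" and \<kappa> :: "'a \<Rightarrow> 'a"
  assumes F: "continuous_on UNIV F"
    and k_lip: "C-lipschitz_on UNIV k"
    and k_supp: "\<And>u. R < norm u \<Longrightarrow> k u = 0"
    and \<kappa>_meas: "\<kappa> \<in> borel_measurable borel"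
    and \<kappa>_bound: "\<And>u. norm (\<kappa> u) \<le> C"
    and \<kappa>_supp: "\<And>u. R < norm u \<Longrightarrow> \<kappa> u = 0"
    and deriv: "AE u in lborel. (k has_derivative (\<lambda>d. \<kappa> u \<bullet> d)) (at u)"
  shows "((\<lambda>x. LINT u|lborel. F (x + u) * k u) has_derivative
           (\<lambda>d. - (LINT u|lborel. F (x + u) * (\<kappa> u \<bullet> d)))) (at x)"
proof -
  have [measurable]: "F \<in> borel_measurable borel" "k \<in> borel_measurable borel" "\<kappa> \<in> borel_measurable borel"
    using F k_lip \<kappa>_meas by (auto intro!: borel_measurable_continuous_onI lipschitz_on_continuous_on)
  have C: "0 \<le> C" using lipschitz_on_nonneg[OF k_lip] .
  have k_diff: "\<bar>k a - k b\<bar> \<le> C * norm (a - b)" for a b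
    using lipschitz_onD[OF k_lip, of a b] by (simp add: dist_norm)
  define D where "D d = - (LINT u|lborel. F (x + u) * (\<kappa> u \<bullet> d))" for d
  have int_\<kappa>: "integrable lborel (\<lambda>u. F (x + u) * (\<kappa> u \<bullet> d))" for d
  proof -
    obtain B where B: "0 \<le> B" "\<And>u. norm u \<le> R \<Longrightarrow> \<bar>F (x + u)\<bar> \<le> B"
      using continuous_bounded_on_cball[OF F] by metis
    show ?thesis
    proof (rule integrable_bounded_support)
      show "\<bar>F (x + u) * (\<kappa> u \<bullet> d)\<bar> \<le> B * (C * norm d)" if "norm u \<le> R" for u
        unfolding abs_mult
        by (intro mult_mono B that C order_trans[OF Cauchy_Schwarz_ineq2] \<kappa>_bound) auto
    qed (use \<kappa>_supp in auto)
  qed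
  have "norm (D d) \<le> norm d * (LINT u|lborel. norm (F (x + u)) * norm (\<kappa> u))" for d
  proof -
    obtain B where B: "0 \<le> B" "\<And>u. norm u \<le> R \<Longrightarrow> \<bar>F (x + u)\<bar> \<le> B"
      using continuous_bounded_on_cball[OF F] by metis
    have int: "integrable lborel (\<lambda>u. norm (F (x + u)) * norm (\<kappa> u))"
    proof (rule integrable_bounded_support)
      show "\<bar>norm (F (x + u)) * norm (\<kappa> u)\<bar> \<le> B * C" if "norm u \<le> R" for u
        unfolding abs_mult using B \<kappa>_bound that by (intro mult_mono) auto
    qed (use \<kappa>_supp in auto)
    have "norm (D d) \<le> (LINT u|lborel. norm (F (x + u) * (\<kappa> u \<bullet> d)))"
      unfolding D_def norm_minus_cancel by (rule integral_norm_bound)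
    also have "\<dots> \<le> (LINT u|lborel. norm d * (norm (F (x + u)) * norm (\<kappa> u)))"
    proof (intro integral_mono integrable_norm int_\<kappa> integrable_mult_right int)
      show "norm (F (x + u) * (\<kappa> u \<bullet> d)) \<le> norm d * (norm (F (x + u)) * norm (\<kappa> u))" for u
        using mult_left_mono[OF Cauchy_Schwarz_ineq2[of "\<kappa> u" d], of "\<bar>F (x + u)\<bar>"]
        by (simp add: abs_mult mult_ac)
    qed
    finally show ?thesis by simp
  qed
  then have "bounded_linear D"
    by (intro bounded_linear_intro)
      (auto simp: D_def inner_right_distrib distrib_left int_\<kappa> Bochner_Integration.integral_add mult.left_commute)
  moreover have "((\<lambda>h. norm ((LINT u|lborel. F (x + h + u) * k u) - (LINT u|lborel. F (x + u) * k u) - D h)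
      / norm h) \<longlongrightarrow> 0) (at 0)"
    unfolding tendsto_at_iff_sequentially
  proof safe
    fix h :: "nat \<Rightarrow> 'a" assume h_ne: "\<forall>i. h i \<in> UNIV - {0}" and h_lim: "h \<longlonglongrightarrow> 0"
    \<comment> \<open>A convergent sequence of increments is bounded. Hence all shifted kernels
      vanish outside one ball, of radius \<open>R + H\<close>, which carries the dominating
      function.\<close>
    obtain H where H: "\<And>i. norm (h i) \<le> H"
      using convergent_imp_Bseq[OF convergentI[OF h_lim]] by (auto simp: Bseq_def)
    have H0: "0 \<le> H" using H[of 0] norm_ge_zero order_trans by blast
    obtain B where B: "0 \<le> B" "\<And>u. norm u \<le> R + H \<Longrightarrow> \<bar>F (x + u)\<bar> \<le> B"
      using continuous_bounded_on_cball[OF F] by metis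
    define r where "r i u = F (x + u) * ((k (u - h i) - k u + \<kappa> u \<bullet> h i) / norm (h i))" for i u
    have h_pos: "norm (h i) > 0" for i using h_ne by auto
    have shift: "(LINT u|lborel. F (x + h i + u) * k u) = (LINT u|lborel. F (x + u) * k (u - h i))" for i
    proof -
      have "(LINT u|lborel. F (x + u) * k (u - h i)) =
         (LINT u|distr lborel borel ((+) (h i)). F (x + u) * k (u - h i))"
        by (simp add: lborel_distr_plus)
      also have "\<dots> = (LINT u|lborel. F (x + h i + u) * k u)"
        by (subst integral_distr) (auto simp: add.assoc)
      finally show ?thesis by simp
    qed
    have supp: "k (u - h i) = 0" "k u = 0" "\<kappa> u = 0" if "R + H < norm u" for u i
    proof -
      have "norm u \<le> norm (u - h i) + norm (h i)" by (simp add: norm_triangle_sub add.commute)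
      then show "k (u - h i) = 0" using that H[of i] by (intro k_supp) auto
      show "k u = 0" "\<kappa> u = 0" using that H0 k_supp \<kappa>_supp by auto
    qed
    have k_bdd: "\<bar>k u\<bar> \<le> C * (2 * \<bar>R\<bar> + 2)" for u
    proof (cases "norm u \<le> R")
      case True
      \<comment> \<open>The point at distance \<open>\<bar>R\<bar> + 1\<close> along a unit vector
        lies outside the support, so \<open>k\<close> vanishes there and the Lipschitz condition
        bounds \<open>k u\<close> by the distance to it. The absolute value covers negative
        \<open>R\<close>.\<close>
      define e :: 'a where "e = (SOME b. b \<in> Basis)"
      have "norm e = 1" unfolding e_def using SOME_Basis norm_Basis by blast
      then have "k ((\<bar>R\<bar> + 1) *\<^sub>R e) = 0" by (intro k_supp) auto
      moreover have "norm (u - (\<bar>R\<bar> + 1) *\<^sub>R e) \<le> norm u + (\<bar>R\<bar> + 1)"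
        using norm_triangle_ineq4[of u "(\<bar>R\<bar> + 1) *\<^sub>R e"] \<open>norm e = 1\<close> by simp
      then have "norm (u - (\<bar>R\<bar> + 1) *\<^sub>R e) \<le> 2 * \<bar>R\<bar> + 2" using True by linarith
      ultimately show ?thesis
        using k_diff[of u "(\<bar>R\<bar> + 1) *\<^sub>R e"] mult_left_mono[OF _ C] order_trans by fastforce
    next
      case False
      then show ?thesis using k_supp[of u] C by auto
    qed
    have int_k: "integrable lborel (\<lambda>u. F (x + u) * k (u - c))" if "c = 0 \<or> c = h i" for c i
    proof (rule integrable_bounded_support)
      show "\<bar>F (x + u) * k (u - c)\<bar> \<le> B * (C * (2 * \<bar>R\<bar> + 2))" if "norm u \<le> R + H" for u
        unfolding abs_mult by (intro mult_mono B that k_bdd) auto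
      show "F (x + u) * k (u - c) = 0" if "R + H < norm u" for u
        using supp[OF that] \<open>c = 0 \<or> c = h i\<close> by auto
    qed auto
    have eq: "((LINT u|lborel. F (x + h i + u) * k u) - (LINT u|lborel. F (x + u) * k u) - D (h i)) / norm (h i)
       = (LINT u|lborel. r i u)" for i
    proof -
      have "(LINT u|lborel. r i u) = (LINT u|lborel. (F (x + u) * k (u - h i) - F (x + u) * k u
          + F (x + u) * (\<kappa> u \<bullet> h i)) / norm (h i))"
        by (simp add: r_def algebra_simps)
      also have "\<dots> = ((LINT u|lborel. F (x + u) * k (u - h i)) - (LINT u|lborel. F (x + u) * k u)
          + (LINT u|lborel. F (x + u) * (\<kappa> u \<bullet> h i))) / norm (h i)"
        using int_k[of "h i" i] int_k[of 0] int_\<kappa> by simp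
      finally show ?thesis unfolding D_def shift by simp
    qed
    have "(\<lambda>i. LINT u|lborel. r i u) \<longlonglongrightarrow> (LINT u|(lborel :: 'a measure). (0::real))"
    proof (rule integral_dominated_convergence)
      show "(\<lambda>u. 0) \<in> borel_measurable lborel" by simp
      show "r i \<in> borel_measurable lborel" for i unfolding r_def by measurable
      show "integrable lborel (\<lambda>u. 2 * B * C * indicat_real (cball (0::'a) (R + H)) u)"
        using emeasure_bounded_finite[OF bounded_cball, of "0::'a" "R + H"]
        by (intro integrable_mult_right integrable_real_indicator) auto
      show "AE u in lborel. norm (r i u) \<le> 2 * B * C * indicat_real (cball 0 (R + H)) u" for i
      proof (rule AE_I2)
        fix u
        show "norm (r i u) \<le> 2 * B * C * indicat_real (cball 0 (R + H)) u"
        proof (cases "norm u \<le> R + H")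
          case True
          have "\<bar>k (u - h i) - k u + \<kappa> u \<bullet> h i\<bar> \<le> C * norm (h i) + C * norm (h i)"
            using k_diff[of "u - h i" u] Cauchy_Schwarz_ineq2[of "\<kappa> u" "h i"]
              mult_right_mono[OF \<kappa>_bound[of u], of "norm (h i)"] by simp
          then have "\<bar>(k (u - h i) - k u + \<kappa> u \<bullet> h i) / norm (h i)\<bar> \<le> 2 * C"
            using h_pos[of i] by (simp add: divide_le_eq)
          then have "norm (r i u) \<le> B * (2 * C)"
            unfolding r_def real_norm_def abs_mult using B True by (intro mult_mono) auto
          then show ?thesis using True by simp
        next
          case False
          then show ?thesis using supp[of u] by (auto simp: r_def)
        qed
      qed
      show "AE u in lborel. (\<lambda>i. r i u) \<longlonglongrightarrow> 0"
        using deriv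
      proof eventually_elim
        fix u assume "(k has_derivative (\<lambda>d. \<kappa> u \<bullet> d)) (at u)"
        then have "((\<lambda>y. norm (k (u + y) - k u - \<kappa> u \<bullet> y) / norm y) \<longlongrightarrow> 0) (at 0)"
          by (simp add: has_derivative_at)
        \<comment> \<open>The kernel argument moves against \<open>x\<close>, so differentiability
          at \<open>u\<close> is used along \<open>- h i\<close>.\<close>
        then have "(\<lambda>i. norm (k (u + - h i) - k u - \<kappa> u \<bullet> (- h i)) / norm (- h i)) \<longlonglongrightarrow> 0"
          unfolding tendsto_at_iff_sequentially
          using h_ne tendsto_minus[OF h_lim] by (auto simp: o_def dest!: spec[of _ "\<lambda>i. - h i"])
        then have "(\<lambda>i. norm ((k (u - h i) - k u + \<kappa> u \<bullet> h i) / norm (h i))) \<longlonglongrightarrow> 0"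
          by simp
        then have "(\<lambda>i. (k (u - h i) - k u + \<kappa> u \<bullet> h i) / norm (h i)) \<longlonglongrightarrow> 0"
          by (rule tendsto_norm_zero_cancel)
        then show "(\<lambda>i. r i u) \<longlonglongrightarrow> 0"
          unfolding r_def by (rule tendsto_mult_right_zero)
      qed
    qed
    then have "(\<lambda>i. norm (LINT u|lborel. r i u)) \<longlonglongrightarrow> 0"
      by (intro tendsto_norm_zero) simp
    then show "((\<lambda>h. norm ((LINT u|lborel. F (x + h + u) * k u) - (LINT u|lborel. F (x + u) * k u) - D h)
      / norm h) \<circ> h) \<longlonglongrightarrow> 0"
      by (simp add: o_def eq[symmetric])
  qed
  ultimately show ?thesis
    unfolding has_derivative_at D_def by blast
qed

section \<open>Scaling of integrals of radially constant functions, and cutoffs of the unit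
  ball\<close>

lemma borel_measurable_sgn_vector [measurable]:
  "sgn \<in> borel_measurable (borel :: 'a::euclidean_space measure)"
  unfolding sgn_div_norm[abs_def] by measurable

text \<open>\<open>\<psi> (sgn u)\<close> does not change when \<open>u\<close> is scaled, so the
  substitution of \<open>r *\<^sub>R u\<close> leaves only the Jacobian. This takes the place of
  polar coordinates when integrals over thin shells are evaluated.\<close>

lemma integral_cball_sgn:
  fixes \<psi> :: "'a::euclidean_space \<Rightarrow> real"
  assumes [measurable]: "\<psi> \<in> borel_measurable borel" and "0 < r"
  shows "(LINT u|lborel. indicator (cball 0 r) u * \<psi> (sgn u)) =
    r ^ DIM('a) * (LINT u|lborel. indicator (cball 0 1) u * \<psi> (sgn u))"
proof -
  have [measurable]: "cball (0::'a) s \<in> sets borel" for s by simp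
  have "(LINT u|lborel. indicator (cball 0 r) u * \<psi> (sgn u)) =
    (LINT u|density (distr lborel borel (\<lambda>x::'a. 0 + r *\<^sub>R x)) (\<lambda>_. ennreal (r ^ DIM('a))). indicator (cball 0 r) u * \<psi> (sgn u))"
    using lborel_affine[of r "0::'a"] \<open>0 < r\<close> by simp
  also have "\<dots> = (LINT u|lborel. r ^ DIM('a) * (indicator (cball 0 r) (r *\<^sub>R u) * \<psi> (sgn (r *\<^sub>R u))))"
    using \<open>0 < r\<close> by (subst integral_density; (subst integral_distr)?) (simp_all, measurable)
  also have "\<dots> = (LINT u|lborel. r ^ DIM('a) * (indicator (cball 0 1) u * \<psi> (sgn u)))"
    using \<open>0 < r\<close> by (intro Bochner_Integration.integral_cong) (auto simp: indicator_def sgn_scaleR)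
  finally show ?thesis by simp
qed

lemma AE_lborel_norm_neq: "AE u in lborel. norm (u::'a::euclidean_space) \<noteq> r"
proof -
  have "sphere (0::'a) r \<in> null_sets lborel"
    using negligible_sphere[of "0::'a" r]
    by (auto simp: null_sets_completion_iff negligible_iff_null_sets negligible_convex_frontier)
  from AE_not_in[OF this] show ?thesis by eventually_elim auto
qed

definition radial_cutoff :: "real \<Rightarrow> 'a::euclidean_space \<Rightarrow> real" where
  "radial_cutoff \<delta> u = max 0 (min 1 ((1 + \<delta> - norm u) / \<delta>))"

lemma radial_cutoff_lipschitz:
  assumes "0 < \<delta>"
  shows "(1 / \<delta>)-lipschitz_on UNIV (radial_cutoff \<delta>)"
proof (rule lipschitz_onI)
  fix u v :: 'a
  have "\<bar>radial_cutoff \<delta> u - radial_cutoff \<delta> v\<bar> \<le> \<bar>(1 + \<delta> - norm u) / \<delta> - (1 + \<delta> - norm v) / \<delta>\<bar>"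
    unfolding radial_cutoff_def by linarith
  also have "\<dots> = \<bar>norm v - norm u\<bar> / \<delta>"
    using assms by (simp add: field_simps flip: diff_divide_distrib)
  also have "\<dots> \<le> norm (v - u) / \<delta>"
    using assms by (intro divide_right_mono norm_triangle_ineq3) auto
  finally show "dist (radial_cutoff \<delta> u) (radial_cutoff \<delta> v) \<le> 1 / \<delta> * dist u v"
    by (simp add: dist_norm norm_minus_commute)
qed (use assms in simp)

lemma radial_cutoff_eq:
  assumes "0 < \<delta>"
  shows "norm u \<le> 1 \<Longrightarrow> radial_cutoff \<delta> u = 1"
    and "1 \<le> norm u \<Longrightarrow> norm u \<le> 1 + \<delta> \<Longrightarrow> radial_cutoff \<delta> u = (1 + \<delta> - norm u) / \<delta>"
    and "1 + \<delta> \<le> norm u \<Longrightarrow> radial_cutoff \<delta> u = 0"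
  using assms by (auto simp: radial_cutoff_def min_def max_def field_simps)

lemma radial_cutoff_has_derivative:
  fixes u :: "'a::euclidean_space"
  assumes \<delta>: "0 < \<delta>" and u: "norm u \<noteq> 1" "norm u \<noteq> 1 + \<delta>"
  shows "(radial_cutoff \<delta> has_derivative
           (\<lambda>d. (if 1 < norm u \<and> norm u \<le> 1 + \<delta> then - (1 / \<delta>) *\<^sub>R sgn u else 0) \<bullet> d)) (at u)"
proof -
  consider "norm u < 1" | "1 < norm u" "norm u < 1 + \<delta>" | "1 + \<delta> < norm u"
    using u by linarith
  then show ?thesis
  proof cases
    case 1
    have "(radial_cutoff \<delta> has_derivative (\<lambda>d. 0)) (at u)"
      by (rule has_derivative_transform_within_open[OF has_derivative_const[of 1] open_ball[of 0 1]])
        (use 1 \<delta> in \<open>auto simp: radial_cutoff_eq\<close>)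
    then show ?thesis using 1 by simp
  next
    case 2
    have "((\<lambda>u. (1 + \<delta> - norm u) / \<delta>) has_derivative (\<lambda>d. (- (1 / \<delta>) *\<^sub>R sgn u) \<bullet> d)) (at u)"
      using 2 \<delta> by (auto intro!: derivative_eq_intros has_derivative_norm simp: inner_commute field_simps)
    moreover have "open {u::'a. 1 < norm u \<and> norm u < 1 + \<delta>}"
      by (intro open_Collect_conj open_Collect_less continuous_intros)
    ultimately have "(radial_cutoff \<delta> has_derivative (\<lambda>d. (- (1 / \<delta>) *\<^sub>R sgn u) \<bullet> d)) (at u)"
      by (rule has_derivative_transform_within_open) (use 2 \<delta> in \<open>auto simp: radial_cutoff_eq\<close>)
    then show ?thesis using 2 by simp
  next
    case 3
    have "open {u::'a. 1 + \<delta> < norm u}"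
      by (intro open_Collect_less continuous_intros)
    then have "(radial_cutoff \<delta> has_derivative (\<lambda>d. 0)) (at u)"
      by (rule has_derivative_transform_within_open[OF has_derivative_const[of 0]])
        (use 3 \<delta> in \<open>auto simp: radial_cutoff_eq\<close>)
    then show ?thesis using 3 by simp
  qed
qed

text \<open>This is the derivative of \<open>t ^ n\<close> at 1. In the shell argument it is the
  limit of shell volume over thickness, relative to the ball, and hence the source of the factor
  \<open>DIM('a)\<close>.\<close>

lemma tendsto_difference_quotient_power:
  assumes "\<delta> \<longlonglongrightarrow> 0" "\<And>m. \<delta> m \<noteq> (0::real)"
  shows "(\<lambda>m. ((1 + \<delta> m) ^ n - 1) / \<delta> m) \<longlonglongrightarrow> real n"
proof -
  have "((\<lambda>h. ((1 + h) ^ n - 1) / h) \<longlongrightarrow> real n) (at (0::real))"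
    using DERIV_pow[of n "1::real" UNIV] unfolding DERIV_def by simp
  then show ?thesis
    using assms by (auto simp: tendsto_at_iff_sequentially o_def)
qed

lemma norm_diff_sgn:
  fixes u :: "'a::real_normed_vector"
  assumes "1 \<le> norm u"
  shows "norm (u - sgn u) = norm u - 1"
proof -
  have "u - sgn u = (norm u - 1) *\<^sub>R sgn u"
    using assms by (cases "u = 0") (auto simp: algebra_simps sgn_div_norm)
  then show ?thesis using assms by (auto simp: norm_sgn)
qed

text \<open>
  The divergence theorem for the ball, without surface measure: the indicator of the ball is
  approximated by radial cutoffs whose gradients live on a thin shell. There the Lipschitz function
  may be replaced by its radial projection \<open>F (x + sgn u)\<close>, and homogeneity turns the shell
  integral into a ball integral.
\<close>
lemma has_derivative_ball_integral:
  fixes F :: "'a::euclidean_space \<Rightarrow> real"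
  assumes lip: "L-lipschitz_on UNIV F"
  shows "((\<lambda>x. LINT u|lborel. indicator (cball 0 1) u * F (x + u)) has_derivative
    (\<lambda>d. real DIM('a) * (LINT u|lborel. indicator (cball 0 1) u * (F (x + sgn u) * (sgn u \<bullet> d))))) (at x)"
    (is "(?A has_derivative ?A' x) (at x)")
proof -
  define V where "V = measure lborel (cball (0::'a) 1)"
  define \<delta> :: "nat \<Rightarrow> real" where "\<delta> m = 1 / real (Suc m)" for m
  have \<delta>: "0 < \<delta> m" "\<delta> m \<le> 1" for m by (auto simp: \<delta>_def)
  have \<delta>_lim: "\<delta> \<longlonglongrightarrow> 0" unfolding \<delta>_def using LIMSEQ_inverse_real_of_nat by (simp add: divide_inverse)
  \<comment> \<open>The shell is written as a difference of two ball indicators, so that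
    \<open>integral_cball_sgn\<close> applies to each of them.\<close>
  define sh :: "nat \<Rightarrow> 'a \<Rightarrow> real" where
    "sh m u = indicator (cball 0 (1 + \<delta> m)) u - indicator (cball 0 1) u" for m u
  have sh_eq: "sh m u = (if 1 < norm u \<and> norm u \<le> 1 + \<delta> m then 1 else 0)" for m u
    using \<delta>[of m] by (auto simp: sh_def indicator_def)
  have [measurable]: "cball (0::'a) r \<in> sets borel" for r by simp
  have [measurable]: "sh m \<in> borel_measurable borel" for m unfolding sh_def by measurable
  have cont: "continuous_on UNIV F" using lip by (rule lipschitz_on_continuous_on)
  then have [measurable]: "F \<in> borel_measurable borel" by (rule borel_measurable_continuous_onI)
  have L: "0 \<le> L" using lip by (rule lipschitz_on_nonneg)
  \<comment> \<open>One bound serves all centres \<open>z\<close> in \<open>ball x 1\<close>: the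
    shells have radius at most 2, which leaves room within 4. Uniformity in \<open>z\<close> is
    required for exchanging limit and derivative below.\<close>
  obtain C where C: "0 \<le> C" "\<And>u. norm u \<le> 4 \<Longrightarrow> \<bar>F (x + u)\<bar> \<le> C"
    using continuous_bounded_on_cball[OF cont] by metis
  have C': "\<bar>F (z + u)\<bar> \<le> C" if "z \<in> ball x 1" "norm u \<le> 3" for z u
  proof -
    have "norm (z - x + u) \<le> norm (z - x) + norm u" by (rule norm_triangle_ineq)
    then have "norm (z - x + u) \<le> 4" using that by (simp add: dist_norm norm_minus_commute)
    then show ?thesis using C(2)[of "z - x + u"] by (simp add: add.assoc[symmetric])
  qed
  have int_bdd: "integrable lborel f" if "f \<in> borel_measurable borel"
      "\<And>u. norm u \<le> 2 \<Longrightarrow> \<bar>f u\<bar> \<le> B" "\<And>u. 2 < norm u \<Longrightarrow> f u = 0" for f :: "'a \<Rightarrow> real" and B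
    using that by (rule integrable_bounded_support)
  have int_sh: "integrable lborel (sh m)" for m
    by (rule int_bdd[where B = 1]) (use \<delta>[of m] in \<open>auto simp: sh_eq\<close>)
  have vol_sh: "(LINT u|lborel. sh m u) = ((1 + \<delta> m) ^ DIM('a) - 1) * V" for m
  proof -
    have "(LINT u|lborel. sh m u) =
       (LINT u|lborel. indicator (cball (0::'a) (1 + \<delta> m)) u) - (LINT u|lborel. indicator (cball (0::'a) 1) u)"
      unfolding sh_def
      by (intro Bochner_Integration.integral_diff; rule int_bdd[where B = 1])
        (use \<delta>[of m] in \<open>auto simp: indicator_def\<close>)
    also have "(LINT u|lborel. indicator (cball (0::'a) (1 + \<delta> m)) u) = (1 + \<delta> m) ^ DIM('a) * V"
      using integral_cball_sgn[of "\<lambda>_::'a. 1" "1 + \<delta> m"] \<delta>[of m] by (simp add: V_def)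
    finally show ?thesis by (simp add: V_def left_diff_distrib)
  qed
  have vol_sh_lim: "(\<lambda>m. LINT u|lborel. sh m u) \<longlonglongrightarrow> 0"
    unfolding vol_sh using \<delta>_lim by (auto intro!: tendsto_eq_intros)
  define f where "f m z = (LINT u|lborel. F (z + u) * radial_cutoff (\<delta> m) u)" for m z
  define \<kappa> :: "nat \<Rightarrow> 'a \<Rightarrow> 'a" where
    "\<kappa> m u = (if 1 < norm u \<and> norm u \<le> 1 + \<delta> m then - (1 / \<delta> m) *\<^sub>R sgn u else 0)" for m u
  define f' where "f' m z d = - (LINT u|lborel. F (z + u) * (\<kappa> m u \<bullet> d))" for m z d
  have deriv: "(f m has_derivative f' m z) (at z)" for m z
    unfolding f_def f'_def
  proof (rule has_derivative_kernel_average[OF cont radial_cutoff_lipschitz[OF \<delta>(1)], where R = "1 + \<delta> m"])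
    show "\<kappa> m \<in> borel_measurable borel" unfolding \<kappa>_def by measurable
    show "norm (\<kappa> m u) \<le> 1 / \<delta> m" for u
      using \<delta>(1)[of m] by (auto simp: \<kappa>_def norm_sgn)
    show "AE u in lborel. (radial_cutoff (\<delta> m) has_derivative (\<bullet>) (\<kappa> m u)) (at u)"
      using AE_lborel_norm_neq[of 1] AE_lborel_norm_neq[of "1 + \<delta> m"]
    proof eventually_elim
      case (elim u)
      then show ?case
        unfolding \<kappa>_def by (intro radial_cutoff_has_derivative \<delta>)
    qed
  qed (use \<delta>[of m] in \<open>auto simp: radial_cutoff_eq \<kappa>_def\<close>)
  have int_F: "integrable lborel (\<lambda>u. indicator (cball 0 1) u * F (z + u))" if "z \<in> ball x 1" for z
    by (rule int_bdd[where B = C]) (use C'[OF that] C in \<open>auto simp: indicator_def\<close>)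
  have f_lim: "(\<lambda>m. f m z) \<longlonglongrightarrow> ?A z" if z: "z \<in> ball x 1" for z
  proof -
    have "\<bar>?A z - f m z\<bar> \<le> C * (LINT u|lborel. sh m u)" for m
    proof -
      have [measurable]: "radial_cutoff (\<delta> m) \<in> borel_measurable (borel :: 'a measure)"
        unfolding radial_cutoff_def by measurable
      have 01: "0 \<le> radial_cutoff (\<delta> m) u" "radial_cutoff (\<delta> m) u \<le> 1" for u :: 'a
        by (auto simp: radial_cutoff_def)
      have int_f: "integrable lborel (\<lambda>u. F (z + u) * radial_cutoff (\<delta> m) u)"
      proof (rule int_bdd)
        show "\<bar>F (z + u) * radial_cutoff (\<delta> m) u\<bar> \<le> C * 1" if "norm u \<le> 2" for u
          unfolding abs_mult using C'[OF z, of u] that 01[of u] C by (intro mult_mono) auto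
      qed (use \<delta>[of m] in \<open>auto simp: radial_cutoff_eq\<close>)
      with int_F[OF z] have eq: "?A z - f m z =
          (LINT u|lborel. indicator (cball 0 1) u * F (z + u) - F (z + u) * radial_cutoff (\<delta> m) u)"
        unfolding f_def by simp
      have "\<bar>?A z - f m z\<bar> \<le> (LINT u|lborel. C * sh m u)"
        unfolding eq
      proof (rule integral_abs_bound_integral)
        fix u
        show "\<bar>indicator (cball 0 1) u * F (z + u) - F (z + u) * radial_cutoff (\<delta> m) u\<bar> \<le> C * sh m u"
        proof -
          consider "norm u \<le> 1" | "1 < norm u" "norm u \<le> 1 + \<delta> m" | "1 + \<delta> m < norm u" by linarith
          then show ?thesis
          proof cases
            case 2
            then have "\<bar>F (z + u)\<bar> * \<bar>radial_cutoff (\<delta> m) u\<bar> \<le> C * 1"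
              using \<delta>[of m] C'[OF z, of u] 01[of u] C by (intro mult_mono) auto
            then show ?thesis using 2 by (simp add: sh_eq abs_mult)
          qed (use \<delta>[of m] C in \<open>auto simp: sh_eq radial_cutoff_eq\<close>)
        qed
      qed (use int_sh int_f int_F[OF z] in auto)
      then show ?thesis by simp
    qed
    then have "norm (f m z - ?A z) \<le> C * (LINT u|lborel. sh m u)" for m
      by (metis abs_minus_commute real_norm_def)
    then have "(\<lambda>m. f m z - ?A z) \<longlonglongrightarrow> 0"
      by (rule Lim_null_comparison[OF always_eventually[OF allI] tendsto_mult_right_zero[OF vol_sh_lim]])
    then show ?thesis by (rule LIM_zero_cancel)
  qed
  \<comment> \<open>On the shell, replacing \<open>F (z + u)\<close> by \<open>F (z + sgn u)\<close>
    costs at most \<open>L * \<delta> m\<close>. Division by \<open>\<delta> m\<close> leaves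
    \<open>L\<close> times the shell volume, which tends to 0. After the replacement the integral is
    exactly a power difference quotient times \<open>J\<close>, which accounts for the second error
    term.\<close>
  have est: "\<bar>f' m z d - ?A' z d\<bar> \<le>
      (L * (LINT u|lborel. sh m u) + C * V * \<bar>((1 + \<delta> m) ^ DIM('a) - 1) / \<delta> m - real DIM('a)\<bar>) * norm d"
    if z: "z \<in> ball x 1" for m z d
  proof -
    have sgn_d: "\<bar>sgn u \<bullet> d\<bar> \<le> norm d" for u
      using Cauchy_Schwarz_ineq2[of "sgn u" d] by (auto simp: norm_sgn split: if_splits)
    define J where "J = (LINT u|lborel. indicator (cball 0 1) u * (F (z + sgn u) * (sgn u \<bullet> d)))"
    have Fs: "\<bar>F (z + sgn u) * (sgn u \<bullet> d)\<bar> \<le> C * norm d" for u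
      unfolding abs_mult using C sgn_d by (intro mult_mono C' z) (auto simp: norm_sgn)
    have int_J: "integrable lborel (\<lambda>u. indicator (cball 0 r) u * (F (z + sgn u) * (sgn u \<bullet> d)))" if "r \<le> 2" for r
    proof (rule int_bdd)
      show "\<bar>indicator (cball 0 r) u * (F (z + sgn u) * (sgn u \<bullet> d))\<bar> \<le> C * norm d" for u
        using Fs[of u] C by (auto simp: indicator_def)
    qed (use that in \<open>auto simp: indicator_def\<close>)
    have "(LINT u|lborel. sh m u * (F (z + sgn u) * (sgn u \<bullet> d))) = ((1 + \<delta> m) ^ DIM('a) - 1) * J"
      unfolding sh_def left_diff_distrib J_def
      using int_J[of 1] int_J[of "1 + \<delta> m"] \<delta>[of m]
        integral_cball_sgn[of "\<lambda>s. F (z + s) * (s \<bullet> d)" "1 + \<delta> m"]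
      by simp
    moreover have int_shF: "integrable lborel (\<lambda>u. sh m u * (F (z + sgn u) * (sgn u \<bullet> d)))"
      unfolding sh_def left_diff_distrib
      using int_J[of 1] int_J[of "1 + \<delta> m"] \<delta>[of m] by simp
    moreover have "f' m z d = (LINT u|lborel. sh m u * (F (z + u) * (sgn u \<bullet> d))) / \<delta> m"
    proof -
      have "f' m z d = (LINT u|lborel. sh m u * (F (z + u) * (sgn u \<bullet> d)) / \<delta> m)"
        unfolding f'_def \<kappa>_def sh_eq
        by (subst integral_minus[symmetric], intro Bochner_Integration.integral_cong) auto
      then show ?thesis by simp
    qed
    moreover have int_shF': "integrable lborel (\<lambda>u. sh m u * (F (z + u) * (sgn u \<bullet> d)))"
    proof (rule int_bdd)
      show "\<bar>sh m u * (F (z + u) * (sgn u \<bullet> d))\<bar> \<le> 1 * (C * norm d)" if "norm u \<le> 2" for u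
        unfolding abs_mult using C sgn_d C'[OF z, of u] that by (intro mult_mono) (auto simp: sh_eq)
    qed (use \<delta>[of m] in \<open>auto simp: sh_eq\<close>)
    ultimately have "f' m z d - ?A' z d =
       (LINT u|lborel. sh m u * ((F (z + u) - F (z + sgn u)) * (sgn u \<bullet> d))) / \<delta> m
       + (((1 + \<delta> m) ^ DIM('a) - 1) / \<delta> m - real DIM('a)) * J"
      unfolding J_def[symmetric] by (simp add: right_diff_distrib left_diff_distrib diff_divide_distrib)
    also have "\<bar>\<dots>\<bar> \<le> (L * (LINT u|lborel. sh m u)) * norm d + 
        \<bar>((1 + \<delta> m) ^ DIM('a) - 1) / \<delta> m - real DIM('a)\<bar> * (C * V * norm d)"
    proof (intro order_trans[OF abs_triangle_ineq] add_mono)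
      have "\<bar>LINT u|lborel. sh m u * ((F (z + u) - F (z + sgn u)) * (sgn u \<bullet> d))\<bar>
          \<le> (LINT u|lborel. L * \<delta> m * norm d * sh m u)"
      proof (rule integral_abs_bound_integral)
        show "\<bar>sh m u * ((F (z + u) - F (z + sgn u)) * (sgn u \<bullet> d))\<bar> \<le> L * \<delta> m * norm d * sh m u" for u
        proof (cases "1 < norm u \<and> norm u \<le> 1 + \<delta> m")
          case True
          have "\<bar>F (z + u) - F (z + sgn u)\<bar> \<le> L * norm (u - sgn u)"
            using lipschitz_onD[OF lip, of "z + u" "z + sgn u"] by (simp add: dist_norm)
          also have "\<dots> \<le> L * \<delta> m" using True L by (intro mult_left_mono) (auto simp: norm_diff_sgn)
          finally have "\<bar>(F (z + u) - F (z + sgn u)) * (sgn u \<bullet> d)\<bar> \<le> L * \<delta> m * norm d"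
            unfolding abs_mult using sgn_d L \<delta>[of m] by (intro mult_mono) auto
          then show ?thesis using True by (simp add: sh_eq)
        next
          case False
          then show ?thesis by (simp only: sh_eq if_False)
        qed
        show "integrable lborel (\<lambda>u. sh m u * ((F (z + u) - F (z + sgn u)) * (sgn u \<bullet> d)))"
          using Bochner_Integration.integrable_diff[OF int_shF' int_shF] by (simp add: algebra_simps)
      qed (use int_sh in auto)
      then show "\<bar>(LINT u|lborel. sh m u * ((F (z + u) - F (z + sgn u)) * (sgn u \<bullet> d))) / \<delta> m\<bar>
          \<le> L * (LINT u|lborel. sh m u) * norm d"
        using \<delta>[of m] by (simp add: divide_le_eq mult_ac)
      have "\<bar>J\<bar> \<le> (LINT u|lborel. C * norm d * indicator (cball (0::'a) 1) u)"
        unfolding J_def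
      proof (rule integral_abs_bound_integral)
        show "\<bar>indicator (cball 0 1) u * (F (z + sgn u) * (sgn u \<bullet> d))\<bar> \<le> C * norm d * indicator (cball 0 1) u" for u
          using Fs[of u] by (auto simp: indicator_def)
        show "integrable lborel (\<lambda>u. C * norm d * indicator (cball (0::'a) 1) u)"
          using C by (intro integrable_mult_right int_bdd[where B = 1]) (auto simp: indicator_def)
      qed (use int_J in auto)
      also have "\<dots> = C * V * norm d" by (simp add: V_def)
      finally show "\<bar>(((1 + \<delta> m) ^ DIM('a) - 1) / \<delta> m - real DIM('a)) * J\<bar>
          \<le> \<bar>((1 + \<delta> m) ^ DIM('a) - 1) / \<delta> m - real DIM('a)\<bar> * (C * V * norm d)"
        unfolding abs_mult by (intro mult_left_mono) auto
    qed
    finally show ?thesis by (simp add: algebra_simps)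
  qed
  have "(\<lambda>m. L * (LINT u|lborel. sh m u) + C * V * \<bar>((1 + \<delta> m) ^ DIM('a) - 1) / \<delta> m - real DIM('a)\<bar>)
      \<longlonglongrightarrow> L * 0 + C * V * \<bar>real DIM('a) - real DIM('a)\<bar>"
    using \<delta>(1) by (intro tendsto_intros vol_sh_lim tendsto_difference_quotient_power \<delta>_lim) (metis less_irrefl)
  then have err: "(\<lambda>m. L * (LINT u|lborel. sh m u) + C * V * \<bar>((1 + \<delta> m) ^ DIM('a) - 1) / \<delta> m - real DIM('a)\<bar>) \<longlonglongrightarrow> 0"
    by simp
  \<comment> \<open>The derivatives converge uniformly on the ball and the functions converge at one
    point, so the limit is differentiable with the limiting derivative. It is identified with the
    ball integral afterwards, through \<open>f_lim\<close>.\<close>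
  have "\<exists>g. \<forall>z\<in>ball x 1. (\<lambda>m. f m z) \<longlonglongrightarrow> g z \<and> (g has_derivative ?A' z) (at z within ball x 1)"
  proof (rule has_derivative_sequence[where f = f and f' = f' and ?x0.0 = x])
    show "(f m has_derivative f' m z) (at z within ball x 1)" for m z
      using deriv by (rule has_derivative_at_withinI)
    show "\<forall>\<^sub>F m in sequentially. \<forall>z\<in>ball x 1. \<forall>h. norm (f' m z h - ?A' z h) \<le> e * norm h" if "e > 0" for e
      using order_tendstoD(2)[OF err that]
    proof eventually_elim
      case (elim m)
      show ?case
      proof safe
        fix z h assume "z \<in> ball x 1"
        show "norm (f' m z h - ?A' z h) \<le> e * norm h"
          unfolding real_norm_def
          by (rule order_trans[OF est[OF \<open>z \<in> ball x 1\<close>] mult_right_mono]) (use elim in auto)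
      qed
    qed
    show "(\<lambda>m. f m x) \<longlonglongrightarrow> ?A x" by (rule f_lim) simp
  qed auto
  then obtain g where g: "\<And>z. z \<in> ball x 1 \<Longrightarrow> (\<lambda>m. f m z) \<longlonglongrightarrow> g z"
    "\<And>z. z \<in> ball x 1 \<Longrightarrow> (g has_derivative ?A' z) (at z within ball x 1)"
    by blast
  have gA: "g z = ?A z" if "z \<in> ball x 1" for z
    using LIMSEQ_unique[OF g(1)[OF that] f_lim[OF that]] .
  have x: "x \<in> ball x 1" by simp
  then have gx: "(g has_derivative ?A' x) (at x)"
    using g(2)[of x] by (simp only: at_within_open[OF _ open_ball])
  show ?thesis
    by (rule has_derivative_transform_within_open[OF gx open_ball x gA])
qed

section \<open>The smoothed objective and the projected gradient step\<close>

lemma sgn_sgn_vector: "sgn (sgn u) = sgn (u :: 'a::real_normed_vector)"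
  by (cases "u = 0") (simp_all add: sgn_div_norm)

lemma sets_uniform_sphere [measurable_cong, simp]: "sets (uniform_sphere r) = sets borel"
  by (simp add: uniform_sphere_def)

lemma space_uniform_sphere [simp]: "space (uniform_sphere r) = UNIV"
  by (simp add: uniform_sphere_def)

text \<open>The two forms agree even at the centre of the ball, where division by zero and
  \<open>sgn\<close> both yield 0.\<close>

lemma uniform_sphere_eq:
  "uniform_sphere r = distr (uniform_measure lborel (cball 0 1)) borel (\<lambda>u::real^'n. r *\<^sub>R sgn u)"
  unfolding uniform_sphere_def by (simp add: sgn_div_norm divide_inverse)

lemma prob_space_uniform_sphere: "prob_space (uniform_sphere r :: (real^'n) measure)"
proof -
  interpret prob_space "uniform_measure lborel (cball (0::real^'n) 1)"
  proof (rule prob_space_uniform_measure)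
    have "measure lborel (cball (0::real^'n) 1) \<noteq> 0" by simp
    then show "emeasure lborel (cball (0::real^'n) 1) \<noteq> 0" by (auto simp: measure_def)
    show "emeasure lborel (cball (0::real^'n) 1) \<noteq> \<infinity>"
      using emeasure_bounded_finite[OF bounded_cball, of "0::real^'n" 1] by auto
  qed
  show ?thesis unfolding uniform_sphere_eq by (intro prob_space_distr) measurable
qed

text \<open>With an inequality in place of equality, the bound holds for the image of every point of
  the ball, including the centre, which is mapped to 0.\<close>

lemma AE_uniform_sphere_norm:
  assumes "0 \<le> r"
  shows "AE v in (uniform_sphere r :: (real^'n) measure). norm v \<le> r"
  unfolding uniform_sphere_eq using assms
  by (subst AE_distr_iff) (auto simp: norm_sgn)

lemma uniform_measure_cball_eq:
  "uniform_measure lborel (cball (0::'a::euclidean_space) 1) =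
    density lborel (\<lambda>u. ennreal (indicator (cball 0 1) u / measure lborel (cball (0::'a) 1)))"
proof -
  have "emeasure lborel (cball (0::'a) 1) = ennreal (measure lborel (cball (0::'a) 1))"
    using emeasure_bounded_finite[OF bounded_cball, of "0::'a" 1]
    by (intro emeasure_eq_ennreal_measure) auto
  then show ?thesis
    unfolding uniform_measure_def
    by (intro arg_cong[where f = "density lborel"] ext)
      (auto simp: indicator_def divide_ennreal[symmetric])
qed

lemma integral_uniform_sphere:
  fixes q :: "real^'n \<Rightarrow> real"
  assumes [measurable]: "q \<in> borel_measurable borel"
  shows "(LINT v|uniform_sphere r. q v) =
    (LINT u|lborel. indicator (cball 0 1) u * q (r *\<^sub>R sgn u)) / measure lborel (cball (0::real^'n) 1)"
proof -
  have [measurable]: "cball (0::real^'n) s \<in> sets borel" for s by simp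
  have "(LINT v|uniform_sphere r. q v) =
    (LINT u|density lborel (\<lambda>u. ennreal (indicator (cball 0 1) u / measure lborel (cball (0::real^'n) 1))). q (r *\<^sub>R sgn u))"
    unfolding uniform_sphere_eq uniform_measure_cball_eq by (subst integral_distr) auto
  also have "\<dots> = (LINT u|lborel. indicator (cball 0 1) u * q (r *\<^sub>R sgn u) / measure lborel (cball (0::real^'n) 1))"
    by (subst integral_density) auto
  finally show ?thesis by simp
qed

lemma integrable_uniform_sphere_bounded:
  fixes q :: "real^'n \<Rightarrow> 'b::{banach, second_countable_topology}"
  assumes "q \<in> borel_measurable borel" "0 \<le> r" "\<And>v. norm v \<le> r \<Longrightarrow> norm (q v) \<le> B"
  shows "integrable (uniform_sphere r) q"
proof -
  interpret prob_space "uniform_sphere r :: (real^'n) measure" by (rule prob_space_uniform_sphere)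
  show ?thesis
  proof (rule integrable_const_bound)
    show "AE v in uniform_sphere r. norm (q v) \<le> B"
      using AE_uniform_sphere_norm[OF assms(2)] by eventually_elim (rule assms(3))
  qed (use assms in simp)
qed

text \<open>The reflection \<open>u\<close> to \<open>- u\<close> preserves Lebesgue measure and the
  ball but changes the sign of the integrand. This is why subtracting the value at the base point
  leaves the gradient estimate unbiased.\<close>

lemma integral_uniform_sphere_sgn: "(LINT v|uniform_sphere r. (sgn v :: real^'n)) = 0"
proof -
  interpret prob_space "uniform_sphere r :: (real^'n) measure" by (rule prob_space_uniform_sphere)
  have [measurable]: "cball (0::real^'n) s \<in> sets borel" for s by simp
  have int: "integrable (uniform_sphere r) (sgn :: real^'n \<Rightarrow> _)"
    by (rule integrable_const_bound[where B = 1]) (auto simp: norm_sgn)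
  define J where "J d = (LINT u|lborel. indicator (cball 0 1) u * (sgn (r *\<^sub>R sgn u) \<bullet> (d::real^'n)))" for d
  have "J d = - J d" for d
  proof -
    have "J d = (LINT u|distr lborel borel (\<lambda>x. 0 + (-1) *\<^sub>R x). indicator (cball 0 1) u * (sgn (r *\<^sub>R sgn u) \<bullet> d))"
      unfolding J_def using lborel_affine[of "-1" "0::real^'n"] by (simp add: density_1)
    also have "\<dots> = - J d"
      unfolding J_def by (subst integral_distr) (auto simp: sgn_minus indicator_def)
    finally show ?thesis .
  qed
  then have J0: "J d = 0" for d by (metis add_eq_0_iff2 double_eq_0_iff)
  have "(LINT v|uniform_sphere r. (sgn v :: real^'n)) \<bullet> d = 0" for d
  proof -
    have "(LINT v|uniform_sphere r. (sgn v :: real^'n)) \<bullet> d = (LINT v|uniform_sphere r. sgn v \<bullet> d)"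
      using int by simp
    also have "\<dots> = 0"
      using J0[of d] by (subst integral_uniform_sphere) (auto simp: J_def)
    finally show ?thesis .
  qed
  then show ?thesis by (metis inner_eq_zero_iff)
qed

text \<open>For positive \<eta> the factor \<open>CARD('n) / \<eta>\<close> is the ratio of surface
  area to volume of the ball of radius \<eta>. It turns the flux integral of the divergence theorem,
  divided by the volume, into an average over normalised surface measure.\<close>

definition sphere_gradient :: "real \<Rightarrow> (real^'n \<Rightarrow> real) \<Rightarrow> real^'n \<Rightarrow> real^'n" where
  "sphere_gradient \<eta> F x = (real CARD('n) / \<eta>) *\<^sub>R (LINT v|uniform_sphere \<eta>. F (x + v) *\<^sub>R sgn v)"

lemma integrable_sphere_gradient:
  fixes F :: "real^'n \<Rightarrow> real"
  assumes "L-lipschitz_on UNIV F" "0 \<le> \<eta>"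
  shows "integrable (uniform_sphere \<eta>) (\<lambda>v. F (x + v) *\<^sub>R sgn v)"
proof -
  have cont: "continuous_on UNIV F" using assms(1) by (rule lipschitz_on_continuous_on)
  then have [measurable]: "F \<in> borel_measurable borel" by (rule borel_measurable_continuous_onI)
  obtain B where B: "0 \<le> B" "\<And>u. norm u \<le> \<eta> \<Longrightarrow> \<bar>F (x + u)\<bar> \<le> B"
    using continuous_bounded_on_cball[OF cont] by metis
  show ?thesis
    by (rule integrable_uniform_sphere_bounded[where B = B]) (use assms B in \<open>auto simp: norm_sgn\<close>)
qed

lemma has_derivative_smoothing:
  fixes F :: "real^'n \<Rightarrow> real"
  assumes lip: "L-lipschitz_on UNIV F" and \<eta>: "0 < \<eta>"
  shows "(smoothing \<eta> F has_derivative (\<lambda>d. sphere_gradient \<eta> F x \<bullet> d)) (at x)"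
proof -
  define V where "V = measure lborel (cball (0::real^'n) 1)"
  have V: "V \<noteq> 0" by (simp add: V_def)
  have [measurable]: "F \<in> borel_measurable borel"
    using lip by (intro borel_measurable_continuous_onI lipschitz_on_continuous_on)
  \<comment> \<open>The unit-ball result is applied to \<open>F\<close> composed with scaling by
    \<eta>, at the point \<open>x / \<eta>\<close>. The chain rule supplies the factor
    \<open>1 / \<eta>\<close>.\<close>
  define A where "A z = (LINT u|lborel. indicator (cball 0 1) u * F (\<eta> *\<^sub>R (z + u)))" for z
  define A' where "A' z d = real DIM(real^'n) * (LINT u|lborel. indicator (cball 0 1) u *
      (F (\<eta> *\<^sub>R (z + sgn u)) * (sgn u \<bullet> d)))" for z d
  have "(L * \<eta>)-lipschitz_on UNIV (\<lambda>z. F (\<eta> *\<^sub>R z))"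
  proof (rule lipschitz_onI)
    show "dist (F (\<eta> *\<^sub>R a)) (F (\<eta> *\<^sub>R b)) \<le> L * \<eta> * dist a b" for a b
      using lipschitz_onD[OF lip, of "\<eta> *\<^sub>R a" "\<eta> *\<^sub>R b"] \<eta>
      by (simp add: dist_norm mult.assoc flip: scaleR_diff_right)
  qed (use lipschitz_on_nonneg[OF lip] \<eta> in simp)
  from has_derivative_ball_integral[OF this]
  have "(A has_derivative A' z) (at z)" for z
    unfolding A_def A'_def .
  then have "((\<lambda>x. A ((1 / \<eta>) *\<^sub>R x) / V) has_derivative (\<lambda>d. A' ((1 / \<eta>) *\<^sub>R x) ((1 / \<eta>) *\<^sub>R d) / V)) (at x)"
    using V by (auto intro!: derivative_eq_intros has_derivative_compose[where g = A, of "\<lambda>x. (1 / \<eta>) *\<^sub>R x"])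
  moreover have "(\<lambda>x. A ((1 / \<eta>) *\<^sub>R x) / V) = smoothing \<eta> F"
    unfolding A_def V_def smoothing_def[abs_def] set_lebesgue_integral_def
    using \<eta> by (simp add: scaleR_add_right)
  moreover have "A' ((1 / \<eta>) *\<^sub>R x) ((1 / \<eta>) *\<^sub>R d) / V = sphere_gradient \<eta> F x \<bullet> d" for d
  proof -
    have "(LINT v|uniform_sphere \<eta>. F (x + v) *\<^sub>R sgn v) \<bullet> d = (LINT v|uniform_sphere \<eta>. F (x + v) * (sgn v \<bullet> d))"
      using integrable_sphere_gradient[OF lip] \<eta> by (subst integral_inner_left[symmetric]) auto
    also have "\<dots> = (LINT u|lborel. indicator (cball 0 1) u * (F (x + \<eta> *\<^sub>R sgn u) * (sgn u \<bullet> d))) / V"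
      using \<eta> by (subst integral_uniform_sphere) (auto simp: V_def sgn_scaleR sgn_sgn_vector)
    finally show ?thesis
      using \<eta> by (simp add: sphere_gradient_def A'_def scaleR_add_right)
  qed
  ultimately show ?thesis by simp
qed

text \<open>The differences are taken under the integral, where \<open>sgn v\<close> has norm at
  most 1. The resulting constant is the smoothness constant behind the stepsize condition: \<gamma>
  times it has to stay below 1.\<close>

lemma sphere_gradient_lipschitz:
  fixes F :: "real^'n \<Rightarrow> real"
  assumes lip: "L-lipschitz_on UNIV F" and \<eta>: "0 < \<eta>"
  shows "(real CARD('n) * L / \<eta>)-lipschitz_on UNIV (sphere_gradient \<eta> F)"
proof (rule lipschitz_onI)
  interpret prob_space "uniform_sphere \<eta> :: (real^'n) measure" by (rule prob_space_uniform_sphere)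
  fix a b
  have int: "integrable (uniform_sphere \<eta>) (\<lambda>v. F (z + v) *\<^sub>R sgn v)" for z
    using integrable_sphere_gradient[OF lip] \<eta> by simp
  have "norm (LINT v|uniform_sphere \<eta>. F (a + v) *\<^sub>R sgn v - F (b + v) *\<^sub>R sgn v)
      \<le> (LINT v|(uniform_sphere \<eta> :: (real^'n) measure). L * dist a b)"
  proof (intro order_trans[OF integral_norm_bound] integral_mono integrable_norm Bochner_Integration.integrable_diff int)
    fix v
    have "norm (F (a + v) *\<^sub>R sgn v - F (b + v) *\<^sub>R sgn v) \<le> \<bar>F (a + v) - F (b + v)\<bar>"
      by (auto simp: norm_sgn simp flip: scaleR_left_diff_distrib)
    also have "\<dots> \<le> L * dist a b"
      using lipschitz_onD[OF lip, of "a + v" "b + v"] by (simp add: dist_norm)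
    finally show "norm (F (a + v) *\<^sub>R sgn v - F (b + v) *\<^sub>R sgn v) \<le> L * dist a b" .
  qed auto
  then have "norm ((LINT v|uniform_sphere \<eta>. F (a + v) *\<^sub>R sgn v) - (LINT v|uniform_sphere \<eta>. F (b + v) *\<^sub>R sgn v))
      \<le> L * dist a b"
    using prob_space by (simp add: int)
  from mult_left_mono[OF this, of "real CARD('n) / \<eta>"]
  show "dist (sphere_gradient \<eta> F a) (sphere_gradient \<eta> F b) \<le> real CARD('n) * L / \<eta> * dist a b"
    using \<eta> unfolding sphere_gradient_def dist_norm scaleR_diff_right[symmetric] norm_scaleR by simp
qed (use lipschitz_on_nonneg[OF lip] \<eta> in simp)

lemma smoothing_close:
  fixes F :: "real^'n \<Rightarrow> real"
  assumes lip: "L-lipschitz_on UNIV F" and \<eta>: "0 < \<eta>"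
  shows "\<bar>smoothing \<eta> F x - F x\<bar> \<le> L * \<eta>"
proof -
  define V where "V = measure lborel (cball (0::real^'n) 1)"
  have V: "0 < V" by (simp add: V_def)
  have [measurable]: "cball (0::real^'n) s \<in> sets borel" for s by simp
  have cont: "continuous_on UNIV F" using lip by (rule lipschitz_on_continuous_on)
  then have [measurable]: "F \<in> borel_measurable borel" by (rule borel_measurable_continuous_onI)
  have L: "0 \<le> L" using lipschitz_on_nonneg[OF lip] .
  have int_ind: "integrable lborel (\<lambda>u. c * indicator (cball (0::real^'n) 1) u)" for c :: real
    by (rule integrable_bounded_support[where R = 1 and B = "\<bar>c\<bar>"]) (auto simp: indicator_def)
  obtain B where B: "0 \<le> B" "\<And>u. norm u \<le> \<eta> \<Longrightarrow> \<bar>F (x + u)\<bar> \<le> B"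
    using continuous_bounded_on_cball[OF cont] by metis
  have int: "integrable lborel (\<lambda>u. indicator (cball 0 1) u * F (x + \<eta> *\<^sub>R u))"
    by (rule integrable_bounded_support[where R = 1 and B = B])
      (use B \<eta> in \<open>auto simp: indicator_def\<close>)
  have "(smoothing \<eta> F x - F x) * V =
      (LINT u|lborel. indicator (cball 0 1) u * F (x + \<eta> *\<^sub>R u)) - (LINT u|lborel. F x * indicator (cball (0::real^'n) 1) u)"
    using V by (simp add: smoothing_def set_lebesgue_integral_def left_diff_distrib flip: V_def)
  also have "\<dots> = (LINT u|lborel. indicator (cball 0 1) u * F (x + \<eta> *\<^sub>R u) - F x * indicator (cball (0::real^'n) 1) u)"
    using int int_ind by simp
  also have "\<bar>\<dots>\<bar> \<le> (LINT u|lborel. (L * \<eta>) * indicator (cball (0::real^'n) 1) u)"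
  proof (intro integral_abs_bound_integral int int_ind Bochner_Integration.integrable_diff)
    fix u
    show "\<bar>indicator (cball 0 1) u * F (x + \<eta> *\<^sub>R u) - F x * indicator (cball 0 1) u\<bar> \<le> (L * \<eta>) * indicator (cball 0 1) u"
    proof (cases "norm u \<le> 1")
      case True
      have "\<bar>F (x + \<eta> *\<^sub>R u) - F x\<bar> \<le> L * (\<eta> * norm u)"
        using lipschitz_onD[OF lip, of "x + \<eta> *\<^sub>R u" x] \<eta> by (simp add: dist_norm)
      also have "\<dots> \<le> L * (\<eta> * 1)" using True \<eta> L by (intro mult_left_mono) auto
      finally show ?thesis using True by simp
    qed simp
  qed
  also have "\<dots> = L * \<eta> * V" by (simp add: V_def)
  finally show ?thesis using V by (simp add: abs_mult)
qed

section \<open>Descent along inexact projected gradient steps\<close>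

lemma descent_lemma:
  fixes \<phi> :: "'a::real_inner \<Rightarrow> real"
  assumes deriv: "\<And>x. (\<phi> has_derivative (\<lambda>d. g x \<bullet> d)) (at x)" and lip: "L-lipschitz_on UNIV g"
  shows "\<phi> b \<le> \<phi> a + g a \<bullet> (b - a) + L / 2 * (norm (b - a))\<^sup>2"
proof -
  define d where "d = b - a"
  \<comment> \<open>\<open>q\<close> is \<phi> along the segment minus the non-constant part of its
    quadratic majorant. Since \<open>g\<close> changes by at most \<open>L * t * norm d\<close>, the
    derivative of \<open>q\<close> is nonpositive, and comparing the endpoints gives the claim
    without integrating \<open>g\<close>.\<close>
  define q where "q t = \<phi> (a + t *\<^sub>R d) - t * (g a \<bullet> d) - L / 2 * t\<^sup>2 * (norm d)\<^sup>2" for t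
  have q': "(q has_real_derivative (g (a + t *\<^sub>R d) \<bullet> d - g a \<bullet> d - L * t * (norm d)\<^sup>2)) (at t)" for t
  proof -
    have "((\<lambda>t. \<phi> (a + t *\<^sub>R d)) has_derivative (\<lambda>s. g (a + t *\<^sub>R d) \<bullet> (s *\<^sub>R d))) (at t)"
      by (rule has_derivative_compose[OF _ deriv]) (auto intro!: derivative_eq_intros)
    then have [derivative_intros]: "((\<lambda>t. \<phi> (a + t *\<^sub>R d)) has_real_derivative g (a + t *\<^sub>R d) \<bullet> d) (at t)"
      by (simp add: has_field_derivative_def mult_commute_abs)
    show ?thesis
      unfolding q_def by (auto intro!: derivative_eq_intros)
  qed
  have "q 1 \<le> q 0"
  proof (rule DERIV_nonpos_imp_nonincreasing[of 0 1 q])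
    fix t :: real assume t: "0 \<le> t" "t \<le> 1"
    have "(g (a + t *\<^sub>R d) - g a) \<bullet> d \<le> norm (g (a + t *\<^sub>R d) - g a) * norm d"
      by (rule norm_cauchy_schwarz)
    also have "\<dots> \<le> (L * (t * norm d)) * norm d"
      using lipschitz_onD[OF lip, of "a + t *\<^sub>R d" a] t by (intro mult_right_mono) (auto simp: dist_norm)
    finally have "g (a + t *\<^sub>R d) \<bullet> d - g a \<bullet> d - L * t * (norm d)\<^sup>2 \<le> 0"
      by (simp add: inner_diff_left power2_eq_square)
    with q' show "\<exists>y. DERIV q t :> y \<and> y \<le> 0" by blast
  qed simp
  then show ?thesis by (simp add: q_def d_def)
qed

text \<open>The converse of the obtuse angle property of projections: when the squared distance from
  \<open>a\<close> to \<open>z\<close> is expanded around \<open>p\<close>, the cross term can only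
  increase it.\<close>

lemma closest_point_unique_dot:
  fixes S :: "'a::euclidean_space set"
  assumes "convex S" "closed S" "p \<in> S" "\<And>z. z \<in> S \<Longrightarrow> (a - p) \<bullet> (z - p) \<le> 0"
  shows "closest_point S a = p"
proof -
  have "dist a p \<le> dist a z" if "z \<in> S" for z
  proof -
    have "(norm (a - z))\<^sup>2 = (norm (a - p))\<^sup>2 - 2 * ((a - p) \<bullet> (z - p)) + (norm (z - p))\<^sup>2"
      unfolding power2_norm_eq_inner by (simp add: inner_diff inner_commute algebra_simps)
    then have "(norm (a - p))\<^sup>2 \<le> (norm (a - z))\<^sup>2" using assms(4)[OF that] zero_le_power2[of "norm (z - p)"] by linarith
    then show ?thesis by (simp add: dist_norm)
  qed
  then show ?thesis using closest_point_unique[of S p a] assms by auto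
qed

text \<open>If \<open>T\<close> has empty interior, two gradients relative to \<open>T\<close> may
  differ. Along a segment inside \<open>T\<close>, however, both give the one-sided derivative of
  the same function of one variable, which is unique.\<close>

lemma gradient_within_convex_unique:
  fixes h :: "'a::euclidean_space \<Rightarrow> real"
  assumes "(h has_derivative (\<lambda>d. g \<bullet> d)) (at x within T)" "(h has_derivative (\<lambda>d. g' \<bullet> d)) (at x within T)"
    and T: "convex T" "x \<in> T" "z \<in> T"
  shows "g \<bullet> (z - x) = g' \<bullet> (z - x)"
proof -
  have D: "((\<lambda>t. h (x + t *\<^sub>R (z - x))) has_vector_derivative (k \<bullet> (z - x))) (at 0 within cbox 0 1)"
    if k: "(h has_derivative (\<lambda>d. k \<bullet> d)) (at x within T)" for k
  proof -
    have "(\<lambda>t. x + t *\<^sub>R (z - x)) ` cbox 0 1 \<subseteq> T"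
      using convexD_alt[OF T] by (auto simp: algebra_simps)
    from has_derivative_subset[OF k this]
    have "(h has_derivative (\<lambda>d. k \<bullet> d)) (at (x + 0 *\<^sub>R (z - x)) within (\<lambda>t. x + t *\<^sub>R (z - x)) ` cbox 0 1)"
      by simp
    moreover have "((\<lambda>t. x + t *\<^sub>R (z - x)) has_derivative (\<lambda>s. s *\<^sub>R (z - x))) (at 0 within cbox 0 1)"
      by (auto intro!: derivative_eq_intros)
    ultimately have "((\<lambda>t. h (x + t *\<^sub>R (z - x))) has_derivative (\<lambda>s. k \<bullet> (s *\<^sub>R (z - x)))) (at 0 within cbox 0 1)"
      by (rule has_derivative_in_compose[rotated])
    then show ?thesis by (simp add: has_vector_derivative_def)
  qed
  show ?thesis
    by (rule vector_derivative_unique_within_closed_interval[OF _ _ D[OF assms(1)] D[OF assms(2)]]) auto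
qed

text \<open>This makes the choice operator in \<open>grad_within\<close> harmless. The variational
  inequality that characterises the projection tests the gradient only against differences of points
  of \<open>X\<close>, and on those all gradients relative to \<open>T\<close> agree.\<close>

lemma closest_point_gradient_step:
  fixes h :: "'a::euclidean_space \<Rightarrow> real"
  assumes g: "(h has_derivative (\<lambda>d. g \<bullet> d)) (at x within T)"
    and X: "convex X" "closed X" "X \<subseteq> T" "x \<in> X" and T: "convex T"
  shows "closest_point X (x - c *\<^sub>R grad_within T h x) = closest_point X (x - c *\<^sub>R g)"
proof (rule closest_point_unique_dot)
  define p where "p = closest_point X (x - c *\<^sub>R g)"
  have p: "p \<in> X" unfolding p_def using X by (intro closest_point_in_set) auto
  have gw: "(h has_derivative (\<lambda>d. grad_within T h x \<bullet> d)) (at x within T)"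
    unfolding grad_within_def using g by (rule someI)
  fix z assume z: "z \<in> X"
  have "grad_within T h x \<bullet> (y - x) = g \<bullet> (y - x)" if "y \<in> X" for y
    using gradient_within_convex_unique[OF gw g T, of y] that X by auto
  from this[OF z] this[OF p] have "grad_within T h x \<bullet> (z - p) = g \<bullet> (z - p)"
    by (simp add: inner_diff_right)
  then have "(x - c *\<^sub>R grad_within T h x - p) \<bullet> (z - p) = (x - c *\<^sub>R g - p) \<bullet> (z - p)"
    by (simp add: inner_diff_left)
  also have "\<dots> \<le> 0" unfolding p_def by (rule closest_point_dot[OF X(1,2) z])
  finally show "(x - c *\<^sub>R grad_within T h x - closest_point X (x - c *\<^sub>R g)) \<bullet>
      (z - closest_point X (x - c *\<^sub>R g)) \<le> 0"
    unfolding p_def .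
qed (use X closest_point_in_set in auto)

text \<open>\<open>s\<close> is any substitute for the gradient, while the residual on the right
  uses the exact one. Exchanging the actual step for the exact step costs
  \<open>(1 - L * \<gamma>) / 2 * \<gamma>\<close> times the squared error, and Young's inequality
  costs another \<open>\<gamma> / 2\<close>. Together they give
  \<open>\<gamma> * (1 - L * \<gamma> / 2)\<close>.\<close>

lemma projected_step_descent:
  fixes \<phi> :: "'a::euclidean_space \<Rightarrow> real"
  assumes deriv: "\<And>x. (\<phi> has_derivative (\<lambda>d. g x \<bullet> d)) (at x)" and lip: "L-lipschitz_on UNIV g"
    and X: "convex X" "closed X" "a \<in> X" and \<gamma>: "0 < \<gamma>" "L * \<gamma> \<le> 1"
  shows "\<phi> (closest_point X (a - \<gamma> *\<^sub>R s)) \<le> \<phi> a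
      - \<gamma> / 4 * (1 - L * \<gamma>) * (norm ((1 / \<gamma>) *\<^sub>R (a - closest_point X (a - \<gamma> *\<^sub>R g a))))\<^sup>2
      + \<gamma> * (1 - L * \<gamma> / 2) * (norm (s - g a))\<^sup>2"
proof -
  define b where "b = closest_point X (a - \<gamma> *\<^sub>R s)"
  define c where "c = closest_point X (a - \<gamma> *\<^sub>R g a)"
  define d where "d = b - a"
  define e where "e = s - g a"
  have desc: "\<phi> b \<le> \<phi> a + g a \<bullet> d + L / 2 * (norm d)\<^sup>2"
    unfolding d_def by (rule descent_lemma[OF deriv lip])
  \<comment> \<open>The variational inequality of the projection is tested with the current point
    \<open>a\<close>, which lies in \<open>X\<close>.\<close>
  have "(a - \<gamma> *\<^sub>R s - b) \<bullet> (a - b) \<le> 0"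
    unfolding b_def by (rule closest_point_dot[OF X])
  moreover have "(a - \<gamma> *\<^sub>R s - b) \<bullet> (a - b) = (norm d)\<^sup>2 + \<gamma> * (g a \<bullet> d) + \<gamma> * (e \<bullet> d)"
    unfolding d_def e_def power2_norm_eq_inner by (simp add: inner_diff inner_commute algebra_simps)
  ultimately have proj: "g a \<bullet> d \<le> - (norm d)\<^sup>2 / \<gamma> - e \<bullet> d"
    using \<gamma>(1) by (simp add: field_simps)
  \<comment> \<open>Young's inequality with weight \<gamma>, so that it uses up exactly half of the
    decrease \<open>(norm d)\<^sup>2 / \<gamma>\<close> gained from the projection.\<close>
  have "0 \<le> (norm (\<gamma> *\<^sub>R e + d))\<^sup>2" by simp
  also have "\<dots> = \<gamma>\<^sup>2 * (norm e)\<^sup>2 + 2 * \<gamma> * (e \<bullet> d) + (norm d)\<^sup>2"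
    unfolding power2_norm_eq_inner by (simp add: inner_add inner_commute algebra_simps power2_eq_square)
  finally have young: "- (e \<bullet> d) \<le> \<gamma> / 2 * (norm e)\<^sup>2 + (norm d)\<^sup>2 / (2 * \<gamma>)"
    using \<gamma>(1) by (simp add: field_simps power2_eq_square)
  have "norm (c - b) \<le> norm ((a - \<gamma> *\<^sub>R g a) - (a - \<gamma> *\<^sub>R s))"
    using closest_point_lipschitz[of X "a - \<gamma> *\<^sub>R g a" "a - \<gamma> *\<^sub>R s"] X
    unfolding b_def c_def dist_norm by auto
  also have "\<dots> = \<gamma> * norm e"
    using \<gamma>(1) by (simp add: e_def norm_minus_commute flip: scaleR_diff_right)
  finally have cb: "norm (c - b) \<le> \<gamma> * norm e" .
  have "norm (a - c) \<le> norm d + \<gamma> * norm e"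
    using norm_triangle_ineq[of "a - b" "b - c"] cb by (simp add: d_def norm_minus_commute)
  then have "(norm (a - c))\<^sup>2 \<le> (norm d + \<gamma> * norm e)\<^sup>2" by (intro power_mono) auto
  also have "\<dots> \<le> 2 * (norm d)\<^sup>2 + 2 * \<gamma>\<^sup>2 * (norm e)\<^sup>2"
    using sum_squares_bound[of "norm d" "\<gamma> * norm e"] by (simp add: power2_sum power_mult_distrib)
  finally have res: "(norm (a - c))\<^sup>2 / 2 - \<gamma>\<^sup>2 * (norm e)\<^sup>2 \<le> (norm d)\<^sup>2" by simp
  have "\<phi> b \<le> \<phi> a - (1 - L * \<gamma>) / (2 * \<gamma>) * (norm d)\<^sup>2 + \<gamma> / 2 * (norm e)\<^sup>2"
  proof -
    have "(1 - L * \<gamma>) / (2 * \<gamma>) * (norm d)\<^sup>2 = (norm d)\<^sup>2 / \<gamma> - (norm d)\<^sup>2 / (2 * \<gamma>) - L / 2 * (norm d)\<^sup>2"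
      using \<gamma>(1) by (simp add: field_simps)
    then show ?thesis using desc proj young by linarith
  qed
  also have "\<dots> \<le> \<phi> a - (1 - L * \<gamma>) / (2 * \<gamma>) * ((norm (a - c))\<^sup>2 / 2 - \<gamma>\<^sup>2 * (norm e)\<^sup>2) + \<gamma> / 2 * (norm e)\<^sup>2"
    using mult_left_mono[OF res, of "(1 - L * \<gamma>) / (2 * \<gamma>)"] \<gamma> by simp
  also have "\<dots> = \<phi> a - \<gamma> / 4 * (1 - L * \<gamma>) * (norm ((1 / \<gamma>) *\<^sub>R (a - c)))\<^sup>2
      + \<gamma> * (1 - L * \<gamma> / 2) * (norm e)\<^sup>2"
  proof -
    have "(norm ((1 / \<gamma>) *\<^sub>R (a - c)))\<^sup>2 = (norm (a - c))\<^sup>2 / \<gamma>\<^sup>2"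
      by (simp add: power_divide)
    then show ?thesis using \<gamma>(1) by (simp add: field_simps power2_eq_square)
  qed
  finally show ?thesis unfolding b_def c_def e_def .
qed

section \<open>The stochastic gradient oracle\<close>

text \<open>Joint measurability follows by rounding the first argument to a countable dense set.\<close>
lemma borel_measurable_caratheodory:
  fixes H :: "'a::{metric_space, second_countable_topology} \<Rightarrow> 'w \<Rightarrow> real"
  assumes meas: "\<And>z. H z \<in> borel_measurable M"
    and cont: "\<And>\<omega>. \<omega> \<in> space M \<Longrightarrow> continuous_on UNIV (\<lambda>z. H z \<omega>)"
  shows "(\<lambda>(z, \<omega>). H z \<omega>) \<in> borel_measurable (borel \<Otimes>\<^sub>M M)"
proof -
  obtain D :: "'a set" where D: "countable D" "\<And>U. open U \<Longrightarrow> U \<noteq> {} \<Longrightarrow> \<exists>d\<in>D. d \<in> U"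
    using countable_dense_setE by blast
  then have "D \<noteq> {}" by (metis empty_iff open_UNIV UNIV_not_empty)
  define d where "d = from_nat_into D"
  have near: "\<exists>i. dist z (d i) < r" if "0 < r" for z r
  proof -
    obtain y where y: "y \<in> D" "y \<in> ball z r" using D(2)[of "ball z r"] \<open>0 < r\<close> by auto
    then obtain i where "d i = y"
      unfolding d_def using from_nat_into_surj[OF D(1)] by metis
    then show ?thesis using y by auto
  qed
  \<comment> \<open>Choosing the least admissible index makes the rounding measurable with values in
    a countable set, so measurability of \<open>H\<close> at the rounded point can be checked one
    index at a time.\<close>
  define idx where "idx m z = (LEAST i. dist z (d i) < 1 / real (Suc m))" for m z
  have idx: "dist z (d (idx m z)) < 1 / real (Suc m)" for m z
    unfolding idx_def by (rule LeastI_ex) (simp add: near)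
  have [measurable]: "idx m \<in> borel \<rightarrow>\<^sub>M count_space UNIV" for m
    unfolding idx_def by measurable
  show ?thesis
  proof (rule borel_measurable_LIMSEQ_real)
    show "(\<lambda>p. H (d (idx m (fst p))) (snd p)) \<in> borel_measurable (borel \<Otimes>\<^sub>M M)" for m
    proof (rule measurable_compose_countable[where g = "\<lambda>p. idx m (fst p)" and f = "\<lambda>i p. H (d i) (snd p)"])
      show "(\<lambda>p. H (d i) (snd p)) \<in> borel_measurable (borel \<Otimes>\<^sub>M M)" for i
        by (rule measurable_compose[OF measurable_snd meas])
    qed measurable
    show "(\<lambda>m. H (d (idx m (fst p))) (snd p)) \<longlonglongrightarrow> (case p of (z, \<omega>) \<Rightarrow> H z \<omega>)"
      if p_space: "p \<in> space (borel \<Otimes>\<^sub>M M)" for p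
    proof -
      obtain z \<omega> where p: "p = (z, \<omega>)" "\<omega> \<in> space M"
        using p_space by (cases p) (auto simp: space_pair_measure)
      have "(\<lambda>m. d (idx m z)) \<longlonglongrightarrow> z"
      proof (rule metric_LIMSEQ_I)
        fix r :: real assume "0 < r"
        then obtain N where N: "1 / real (Suc N) < r" using nat_approx_posE by blast
        have "dist (d (idx m z)) z < r" if "N \<le> m" for m
        proof -
          have "1 / real (Suc m) \<le> 1 / real (Suc N)" using that by (simp add: frac_le)
          then show ?thesis using idx[of z m] N by (simp add: dist_commute)
        qed
        then show "\<exists>N. \<forall>m\<ge>N. dist (d (idx m z)) z < r" by blast
      qed
      then show ?thesis
        unfolding p using continuous_on_tendsto_compose[OF cont[OF p(2)]] by simp
    qed
  qed
qed

lemma (in prob_space) square_expectation_le: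
  fixes f :: "'a \<Rightarrow> real"
  assumes "f \<in> borel_measurable M" "integrable M (\<lambda>x. (f x)\<^sup>2)"
  shows "integrable M f" and "(expectation f)\<^sup>2 \<le> expectation (\<lambda>x. (f x)\<^sup>2)"
proof -
  show int: "integrable M f" by (rule square_integrable_imp_integrable[OF assms])
  show "(expectation f)\<^sup>2 \<le> expectation (\<lambda>x. (f x)\<^sup>2)"
    using variance_eq[OF int assms(2)] variance_positive[of f] by simp
qed

lemma (in prob_space) second_moment_centered_le:
  fixes Z :: "'a \<Rightarrow> 'b::euclidean_space"
  assumes int: "integrable M Z" and sq: "integrable M (\<lambda>x. (norm (Z x))\<^sup>2)"
  shows "integrable M (\<lambda>x. (norm (Z x - expectation Z))\<^sup>2)"
    and "expectation (\<lambda>x. (norm (Z x - expectation Z))\<^sup>2) \<le> expectation (\<lambda>x. (norm (Z x))\<^sup>2)"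
proof -
  have eq: "(norm (Z x - expectation Z))\<^sup>2 = (norm (Z x))\<^sup>2 - 2 * (Z x \<bullet> expectation Z) + (norm (expectation Z))\<^sup>2" for x
    unfolding power2_norm_eq_inner by (simp add: inner_diff inner_commute)
  show "integrable M (\<lambda>x. (norm (Z x - expectation Z))\<^sup>2)"
    unfolding eq using int sq by simp
  have "expectation (\<lambda>x. (norm (Z x - expectation Z))\<^sup>2) =
      expectation (\<lambda>x. (norm (Z x))\<^sup>2) - 2 * (expectation Z \<bullet> expectation Z) + (norm (expectation Z))\<^sup>2"
    unfolding eq using int sq prob_space by simp
  then show "expectation (\<lambda>x. (norm (Z x - expectation Z))\<^sup>2) \<le> expectation (\<lambda>x. (norm (Z x))\<^sup>2)"
    by (simp add: power2_norm_eq_inner)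
qed

text \<open>\<open>H\<close> stands for a sampled objective already extended to the whole space, so
  no domain conditions accompany the oracle. The Lipschitz constant is random and only square
  integrable; the samples are therefore controlled in mean square and not uniformly.\<close>

locale zo_oracle = prob_space M for M :: "'w measure" +
  fixes H :: "real^'n \<Rightarrow> 'w \<Rightarrow> real" and \<Lambda> :: "'w \<Rightarrow> real" and L \<eta> :: real
  assumes integrable_H: "\<And>z. integrable M (H z)"
    and H_lipschitz: "\<And>\<omega>. \<omega> \<in> space M \<Longrightarrow> (\<Lambda> \<omega>)-lipschitz_on UNIV (\<lambda>z. H z \<omega>)"
    and \<Lambda>_measurable [measurable]: "\<Lambda> \<in> borel_measurable M"
    and \<Lambda>_square: "integrable M (\<lambda>\<omega>. (\<Lambda> \<omega>)\<^sup>2)"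
    and L_eq: "L = sqrt (LINT \<omega>|M. (\<Lambda> \<omega>)\<^sup>2)"
    and \<eta>_pos: "0 < \<eta>"
begin

definition "H_mean z = (LINT \<omega>|M. H z \<omega>)"
definition "sample_law = (uniform_sphere \<eta> :: (real^'n) measure) \<Otimes>\<^sub>M M"
definition "g z p = zo_gradient H \<eta> z (fst p) (snd p)"
definition "grad z = sphere_gradient \<eta> H_mean z"

lemma \<Lambda>_nonneg: "\<omega> \<in> space M \<Longrightarrow> 0 \<le> \<Lambda> \<omega>"
  by (rule lipschitz_on_nonneg[OF H_lipschitz])

lemma L_nonneg: "0 \<le> L"
  unfolding L_eq by simp

lemma L_square: "L\<^sup>2 = (LINT \<omega>|M. (\<Lambda> \<omega>)\<^sup>2)"
  unfolding L_eq by simp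

lemma integrable_\<Lambda>: "integrable M \<Lambda>"
  by (rule square_expectation_le[OF \<Lambda>_measurable \<Lambda>_square])

lemma expectation_\<Lambda>_le: "expectation \<Lambda> \<le> L"
  using square_expectation_le(2)[OF \<Lambda>_measurable \<Lambda>_square]
  by (intro power2_le_imp_le[OF _ L_nonneg]) (simp add: L_square)

lemma H_diff: "\<omega> \<in> space M \<Longrightarrow> \<bar>H a \<omega> - H b \<omega>\<bar> \<le> \<Lambda> \<omega> * norm (a - b)"
  using lipschitz_onD[OF H_lipschitz, of \<omega> a b] by (simp add: dist_norm)

lemma H_mean_lipschitz: "L-lipschitz_on UNIV H_mean"
proof (rule lipschitz_onI)
  fix a b
  have "\<bar>H_mean a - H_mean b\<bar> = \<bar>LINT \<omega>|M. H a \<omega> - H b \<omega>\<bar>"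
    unfolding H_mean_def using integrable_H by simp
  also have "\<dots> \<le> (LINT \<omega>|M. \<bar>H a \<omega> - H b \<omega>\<bar>)"
    by (rule integral_abs_bound)
  also have "\<dots> \<le> (LINT \<omega>|M. \<Lambda> \<omega> * norm (a - b))"
    using integrable_H integrable_\<Lambda> H_diff by (intro integral_mono) auto
  also have "\<dots> \<le> L * norm (a - b)"
    using expectation_\<Lambda>_le by (simp add: mult_right_mono)
  finally show "dist (H_mean a) (H_mean b) \<le> L * dist a b" by (simp add: dist_norm)
qed (rule L_nonneg)

lemma H_measurable: "(\<lambda>(z, \<omega>). H z \<omega>) \<in> borel_measurable (borel \<Otimes>\<^sub>M M)"
proof (rule borel_measurable_caratheodory)
  show "H z \<in> borel_measurable M" for z
    using integrable_H by (rule borel_measurable_integrable)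
  show "continuous_on UNIV (\<lambda>z. H z \<omega>)" if "\<omega> \<in> space M" for \<omega>
    using H_lipschitz[OF that] by (rule lipschitz_on_continuous_on)
qed

text \<open>Measurability in both arguments jointly is required because the oracle is evaluated at a
  random iterate.\<close>

lemma g_measurable: "(\<lambda>(z, p). g z p) \<in> borel_measurable (borel \<Otimes>\<^sub>M (borel \<Otimes>\<^sub>M M))"
proof -
  have [measurable]: "(\<lambda>q. H (fst q + fst (snd q)) (snd (snd q))) \<in> borel_measurable (borel \<Otimes>\<^sub>M (borel \<Otimes>\<^sub>M M))"
    by (rule measurable_compose[OF _ H_measurable, where f = "\<lambda>q. (fst q + fst (snd q), snd (snd q))", simplified]) measurable
  have [measurable]: "(\<lambda>q. H (fst q) (snd (snd q))) \<in> borel_measurable (borel \<Otimes>\<^sub>M (borel \<Otimes>\<^sub>M M))"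
    by (rule measurable_compose[OF _ H_measurable, where f = "\<lambda>q. (fst q, snd (snd q))", simplified]) measurable
  show ?thesis unfolding g_def zo_gradient_def split_beta' by measurable
qed

lemma sample_law_prob_space: "prob_space sample_law"
proof -
  interpret U: prob_space "uniform_sphere \<eta> :: (real^'n) measure" by (rule prob_space_uniform_sphere)
  interpret pair_prob_space "uniform_sphere \<eta> :: (real^'n) measure" M ..
  show ?thesis unfolding sample_law_def by (rule prob_space_axioms)
qed

lemma sets_sample_law [measurable_cong, simp]: "sets sample_law = sets (borel \<Otimes>\<^sub>M M)"
  unfolding sample_law_def by (intro sets_pair_measure_cong) auto

lemma g_measurable_snd [measurable]: "g z \<in> borel_measurable (borel \<Otimes>\<^sub>M M)"
  using measurable_Pair2[OF g_measurable, of z] by simp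

lemma g_eq: "g z (v, \<omega>) = (real CARD('n) / \<eta>) *\<^sub>R ((H (z + v) \<omega> - H z \<omega>) *\<^sub>R sgn v)"
  by (simp add: g_def zo_gradient_def sgn_div_norm field_simps)

lemma norm_g_le:
  assumes "norm v \<le> \<eta>" "\<omega> \<in> space M"
  shows "norm (g z (v, \<omega>)) \<le> real CARD('n) * \<Lambda> \<omega>"
proof -
  have "\<bar>H (z + v) \<omega> - H z \<omega>\<bar> \<le> \<Lambda> \<omega> * norm v" using H_diff[OF assms(2), of "z + v" z] by simp
  also have "\<dots> \<le> \<Lambda> \<omega> * \<eta>" using assms \<Lambda>_nonneg by (intro mult_left_mono) auto
  finally have "\<bar>H (z + v) \<omega> - H z \<omega>\<bar> * norm (sgn v) \<le> \<Lambda> \<omega> * \<eta> * 1"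
    using \<eta>_pos \<Lambda>_nonneg[OF assms(2)] by (intro mult_mono) (auto simp: norm_sgn)
  from mult_left_mono[OF this, of "real CARD('n) / \<eta>"] show ?thesis
    using \<eta>_pos by (simp add: g_eq abs_mult mult.assoc)
qed

text \<open>The quantifier over \<open>z\<close> stands inside \<open>AE\<close>: one null set
  serves all points, so a random iterate may be substituted for \<open>z\<close>.\<close>

lemma AE_norm_g_le: "AE p in sample_law. \<forall>z. norm (g z p) \<le> real CARD('n) * \<Lambda> (snd p)"
proof -
  interpret U: prob_space "uniform_sphere \<eta> :: (real^'n) measure" by (rule prob_space_uniform_sphere)
  interpret pair_prob_space "uniform_sphere \<eta> :: (real^'n) measure" M ..
  have "AE p in sample_law. norm (fst p) \<le> \<eta>"
    unfolding sample_law_def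
  proof (rule AE_pair_measure)
    show "AE v in uniform_sphere \<eta>. AE \<omega> in M. norm (fst (v :: real^'n, \<omega>)) \<le> \<eta>"
      using AE_uniform_sphere_norm[of \<eta>] \<eta>_pos by simp
  qed measurable
  moreover have "AE p in sample_law. snd p \<in> space M"
    by (rule AE_I2) (auto simp: sample_law_def space_pair_measure)
  ultimately show ?thesis
    by eventually_elim (metis norm_g_le prod.collapse)
qed

lemma \<Lambda>_sample_law:
  "integrable sample_law (\<lambda>p. (\<Lambda> (snd p))\<^sup>2)" "(LINT p|sample_law. (\<Lambda> (snd p))\<^sup>2) = L\<^sup>2"
proof -
  interpret U: prob_space "uniform_sphere \<eta> :: (real^'n) measure" by (rule prob_space_uniform_sphere)
  have distr: "distr sample_law M snd = M"
  proof (rule measure_eqI)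
    fix A assume "A \<in> sets (distr sample_law M snd)"
    then have A: "A \<in> sets M" by simp
    have "emeasure (distr sample_law M snd) A = emeasure sample_law (UNIV \<times> A)"
      using A sets.sets_into_space[OF A]
      by (subst emeasure_distr) (auto simp: sample_law_def space_pair_measure intro!: arg_cong[where f = "emeasure _"])
    also have "\<dots> = emeasure M A"
      unfolding sample_law_def using A U.emeasure_space_1
      by (subst emeasure_pair_measure_Times) auto
    finally show "emeasure (distr sample_law M snd) A = emeasure M A" .
  qed simp
  have "integrable (distr sample_law M snd) (\<lambda>\<omega>. (\<Lambda> \<omega>)\<^sup>2)"
    unfolding distr by (rule \<Lambda>_square)
  then show "integrable sample_law (\<lambda>p. (\<Lambda> (snd p))\<^sup>2)"
    by (subst (asm) integrable_distr_eq) auto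
  have "L\<^sup>2 = (LINT \<omega>|distr sample_law M snd. (\<Lambda> \<omega>)\<^sup>2)"
    unfolding distr by (rule L_square)
  also have "\<dots> = (LINT p|sample_law. (\<Lambda> (snd p))\<^sup>2)"
    by (subst integral_distr) auto
  finally show "(LINT p|sample_law. (\<Lambda> (snd p))\<^sup>2) = L\<^sup>2" by simp
qed

lemma g_square_integrable: "integrable sample_law (\<lambda>p. (norm (g z p))\<^sup>2)"
  and g_second_moment: "(LINT p|sample_law. (norm (g z p))\<^sup>2) \<le> (real CARD('n))\<^sup>2 * L\<^sup>2"
proof -
  have bound: "AE p in sample_law. (norm (g z p))\<^sup>2 \<le> (real CARD('n))\<^sup>2 * (\<Lambda> (snd p))\<^sup>2"
    using AE_norm_g_le
  proof eventually_elim
    case (elim p)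
    from power_mono[OF this[rule_format] norm_ge_zero, of z 2] show ?case by (simp add: power_mult_distrib)
  qed
  have int: "integrable sample_law (\<lambda>p. (real CARD('n))\<^sup>2 * (\<Lambda> (snd p))\<^sup>2)"
    using \<Lambda>_sample_law(1) by simp
  show *: "integrable sample_law (\<lambda>p. (norm (g z p))\<^sup>2)"
    by (rule Bochner_Integration.integrable_bound[OF int]) (use bound in auto)
  have "(LINT p|sample_law. (norm (g z p))\<^sup>2) \<le> (LINT p|sample_law. (real CARD('n))\<^sup>2 * (\<Lambda> (snd p))\<^sup>2)"
    by (rule integral_mono_AE[OF * int bound])
  then show "(LINT p|sample_law. (norm (g z p))\<^sup>2) \<le> (real CARD('n))\<^sup>2 * L\<^sup>2"
    by (simp add: \<Lambda>_sample_law(2))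
qed

lemma g_integrable: "integrable sample_law (g z)"
proof -
  interpret S: prob_space sample_law by (rule sample_law_prob_space)
  have "integrable sample_law (\<lambda>p. norm (g z p))"
    by (rule S.square_expectation_le(1)[OF _ g_square_integrable]) measurable
  then show ?thesis by (subst (asm) integrable_norm_iff) auto
qed

text \<open>Integrating over \<omega> first replaces \<open>H\<close> by \<open>H_mean\<close>. The
  base value \<open>H_mean z\<close> is then constant on the sphere and contributes a multiple of
  the mean direction, which is 0.\<close>

lemma expectation_g: "(LINT p|sample_law. g z p) = grad z"
proof -
  interpret U: prob_space "uniform_sphere \<eta> :: (real^'n) measure" by (rule prob_space_uniform_sphere)
  interpret pair_prob_space "uniform_sphere \<eta> :: (real^'n) measure" M ..
  have "(LINT p|sample_law. g z p) = (LINT v|uniform_sphere \<eta>. LINT \<omega>|M. g z (v, \<omega>))"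
    using g_integrable[of z] unfolding sample_law_def by (subst integral_fst') auto
  also have "\<dots> = (LINT v|uniform_sphere \<eta>. (real CARD('n) / \<eta>) *\<^sub>R (H_mean (z + v) *\<^sub>R sgn v - H_mean z *\<^sub>R sgn v))"
    unfolding g_eq H_mean_def using integrable_H by (simp add: scaleR_left_diff_distrib)
  also have "\<dots> = (real CARD('n) / \<eta>) *\<^sub>R ((LINT v|uniform_sphere \<eta>. H_mean (z + v) *\<^sub>R sgn v) - H_mean z *\<^sub>R (LINT v|uniform_sphere \<eta>. sgn v))"
  proof -
    have "integrable (uniform_sphere \<eta>) (sgn :: real^'n \<Rightarrow> real^'n)"
      by (rule U.integrable_const_bound[where B = 1]) (auto simp: norm_sgn)
    moreover have "integrable (uniform_sphere \<eta>) (\<lambda>v. H_mean (z + v) *\<^sub>R sgn v)"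
      using integrable_sphere_gradient[OF H_mean_lipschitz] \<eta>_pos by simp
    ultimately show ?thesis
      by (simp only: integral_scaleR_right Bochner_Integration.integral_diff integrable_scaleR_right)
  qed
  also have "\<dots> = grad z"
    by (simp add: integral_uniform_sphere_sgn grad_def sphere_gradient_def)
  finally show ?thesis .
qed

lemma g_variance:
  "integrable sample_law (\<lambda>p. (norm (g z p - grad z))\<^sup>2)"
  "(LINT p|sample_law. (norm (g z p - grad z))\<^sup>2) \<le> (real CARD('n))\<^sup>2 * L\<^sup>2"
  using prob_space.second_moment_centered_le[OF sample_law_prob_space g_integrable g_square_integrable, of z]
    g_second_moment[of z]
  by (auto simp: expectation_g)

lemma norm_grad_le: "norm (grad z) \<le> real CARD('n) * L"
proof -
  interpret S: prob_space sample_law by (rule sample_law_prob_space)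
  have "norm (grad z) \<le> S.expectation (\<lambda>p. norm (g z p))"
    unfolding expectation_g[symmetric] by (rule integral_norm_bound)
  then have "(norm (grad z))\<^sup>2 \<le> (S.expectation (\<lambda>p. norm (g z p)))\<^sup>2" by (rule power_mono) simp
  also have "\<dots> \<le> S.expectation (\<lambda>p. (norm (g z p))\<^sup>2)"
    by (rule S.square_expectation_le(2)[OF _ g_square_integrable]) measurable
  also have "\<dots> \<le> (real CARD('n) * L)\<^sup>2" using g_second_moment[of z] by (simp add: power_mult_distrib)
  finally show ?thesis by (rule power2_le_imp_le) (simp add: L_nonneg)
qed

lemma grad_lipschitz: "(real CARD('n) * L / \<eta>)-lipschitz_on UNIV grad"
  using sphere_gradient_lipschitz[OF H_mean_lipschitz \<eta>_pos] unfolding grad_def[abs_def] by simp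

lemma grad_measurable [measurable]: "grad \<in> borel_measurable borel"
  using grad_lipschitz by (intro borel_measurable_continuous_onI lipschitz_on_continuous_on)

lemma smoothing_has_derivative: "(smoothing \<eta> H_mean has_derivative (\<lambda>d. grad z \<bullet> d)) (at z)"
  unfolding grad_def by (rule has_derivative_smoothing[OF H_mean_lipschitz \<eta>_pos])

end

section \<open>The stochastic recursion\<close>

lemma closest_point_measurable:
  fixes X :: "'a::euclidean_space set"
  assumes "convex X" "closed X" "X \<noteq> {}"
  shows "closest_point X \<in> borel_measurable borel"
  by (rule borel_measurable_continuous_onI[OF continuous_on_closest_point[OF assms]])

lemma inner_abs_le_squares: "\<bar>(a::'a::real_inner) \<bullet> b\<bar> \<le> (norm a)\<^sup>2 + (norm b)\<^sup>2"
proof -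
  have "\<bar>a \<bullet> b\<bar> \<le> norm a * norm b" by (rule Cauchy_Schwarz_ineq2)
  moreover have "2 * (norm a * norm b) \<le> (norm a)\<^sup>2 + (norm b)\<^sup>2"
    using sum_squares_bound[of "norm a" "norm b"] by simp
  moreover have "0 \<le> norm a * norm b" by simp
  ultimately show ?thesis by linarith
qed

locale zo_scheme = zo_oracle M H \<Lambda> L \<eta> + P: prob_space P
  for M :: "'w measure" and H :: "real^'n \<Rightarrow> 'w \<Rightarrow> real" and \<Lambda> L \<eta> and P :: "'s measure" +
  fixes X :: "(real^'n) set" and \<gamma> :: real and x0 :: "real^'n"
    and \<xi> :: "nat \<times> nat \<Rightarrow> 's \<Rightarrow> (real^'n) \<times> 'w"
  assumes X: "convex X" "closed X" "bounded X" and x0: "x0 \<in> X" and \<gamma>_pos: "0 < \<gamma>"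
    and \<xi>_law: "\<And>i. i \<in> sample_index \<Longrightarrow> distr P (borel \<Otimes>\<^sub>M M) (\<xi> i) = sample_law"
    and \<xi>_indep: "P.indep_vars (\<lambda>_. borel \<Otimes>\<^sub>M M) \<xi> sample_index"
begin

lemma X_ne: "X \<noteq> {}" using x0 by auto

lemma \<xi>_measurable: "i \<in> sample_index \<Longrightarrow> \<xi> i \<in> P \<rightarrow>\<^sub>M borel \<Otimes>\<^sub>M M"
  using \<xi>_indep by (auto simp: P.indep_vars_def)

lemma closest_point_X_measurable [measurable]: "closest_point X \<in> borel_measurable borel"
  using X X_ne by (intro closest_point_measurable)

definition "batch_gradient k z \<omega> =
  (1 / real (batch_size k)) *\<^sub>R (\<Sum>j = 1..batch_size k. g z (\<omega> (k, j)))"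

text \<open>The recursion runs on a deterministic table of samples rather than on the probability
  space. Measurability and independence of an iterate can then be read off from the entries on which
  it depends.\<close>

primrec iter :: "nat \<Rightarrow> (nat \<times> nat \<Rightarrow> (real^'n) \<times> 'w) \<Rightarrow> real^'n" where
  "iter 0 \<omega> = x0"
| "iter (Suc k) \<omega> = closest_point X (iter k \<omega> - \<gamma> *\<^sub>R batch_gradient k (iter k \<omega>) \<omega>)"

text \<open>The restriction makes the table an extensional function, that is, a point of the product
  space over \<open>sample_index\<close>.\<close>

definition "samples s = (\<lambda>i\<in>sample_index. \<xi> i s)"
definition "xi k s = iter k (samples s)"

lemma iter_in_X: "iter k \<omega> \<in> X"
  using X X_ne x0 by (cases k) (auto intro: closest_point_in_set)

lemma xi_in_X: "xi k s \<in> X"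
  unfolding xi_def by (rule iter_in_X)

lemma iter_cong:
  assumes "\<And>i j. (i, j) \<in> sample_index \<Longrightarrow> i < k \<Longrightarrow> \<omega> (i, j) = \<omega>' (i, j)"
  shows "iter k \<omega> = iter k \<omega>'"
  using assms
proof (induction k)
  case (Suc k)
  have "iter k \<omega> = iter k \<omega>'" by (rule Suc.IH) (rule Suc.prems, auto)
  moreover have "batch_gradient k z \<omega> = batch_gradient k z \<omega>'" for z
    unfolding batch_gradient_def
    by (intro arg_cong[where f = "\<lambda>v. _ *\<^sub>R v"] sum.cong refl arg_cong[where f = "g z"] Suc.prems)
      (auto simp: sample_index_def)
  ultimately show ?case by simp
qed simp

lemma g_comp_measurable:
  assumes "a \<in> borel_measurable N" "b \<in> N \<rightarrow>\<^sub>M borel \<Otimes>\<^sub>M M"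
  shows "(\<lambda>\<omega>. g (a \<omega>) (b \<omega>)) \<in> borel_measurable N"
  using measurable_compose[OF measurable_Pair[OF assms] g_measurable] by simp

text \<open>The index set \<open>A\<close> is left open so that the result covers both the full
  table and the table with one sample of round \<open>k\<close> removed.\<close>

lemma iter_measurable:
  assumes "\<And>i j. (i, j) \<in> sample_index \<Longrightarrow> i < k \<Longrightarrow> (i, j) \<in> A"
  shows "iter k \<in> borel_measurable (PiM A (\<lambda>_. borel \<Otimes>\<^sub>M M))"
  using assms
proof (induction k)
  case 0
  have "iter 0 = (\<lambda>\<omega>. x0)" by (rule ext) simp
  then show ?case by simp
next
  case (Suc k)
  have IH [measurable]: "iter k \<in> borel_measurable (PiM A (\<lambda>_. borel \<Otimes>\<^sub>M M))"
    by (rule Suc.IH) (rule Suc.prems, auto)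
  have [measurable]: "(\<lambda>\<omega>. batch_gradient k (iter k \<omega>) \<omega>) \<in> borel_measurable (PiM A (\<lambda>_. borel \<Otimes>\<^sub>M M))"
    unfolding batch_gradient_def
  proof (intro borel_measurable_scaleR borel_measurable_const borel_measurable_sum g_comp_measurable IH)
    fix j assume "j \<in> {1..batch_size k}"
    then have "(k, j) \<in> A" by (intro Suc.prems) (auto simp: sample_index_def)
    then show "(\<lambda>\<omega>. \<omega> (k, j)) \<in> PiM A (\<lambda>_. borel \<Otimes>\<^sub>M M) \<rightarrow>\<^sub>M borel \<Otimes>\<^sub>M M"
      by (rule measurable_component_singleton)
  qed
  show ?case by simp
qed

lemma samples_measurable [measurable]: "samples \<in> P \<rightarrow>\<^sub>M PiM sample_index (\<lambda>_. borel \<Otimes>\<^sub>M M)"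
  unfolding samples_def[abs_def] by (intro measurable_restrict \<xi>_measurable)

lemma xi_measurable [measurable]: "xi k \<in> borel_measurable P"
  unfolding xi_def[abs_def] by (rule measurable_compose[OF samples_measurable iter_measurable])

text \<open>The iterates stay in the compact set \<open>X\<close>, where a continuous function is
  bounded.\<close>

lemma integrable_xi:
  fixes h :: "real^'n \<Rightarrow> real"
  assumes "continuous_on UNIV h"
  shows "integrable P (\<lambda>s. h (xi k s))"
proof -
  have "compact (h ` X)"
    using X by (intro compact_continuous_image continuous_on_subset[OF assms]) (auto simp: compact_eq_bounded_closed)
  then obtain B where "\<And>y. y \<in> h ` X \<Longrightarrow> norm y \<le> B"
    using compact_imp_bounded bounded_iff by metis
  then have "AE s in P. norm (h (xi k s)) \<le> B"
    using xi_in_X by auto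
  moreover have "(\<lambda>s. h (xi k s)) \<in> borel_measurable P"
    by (rule measurable_compose[OF xi_measurable borel_measurable_continuous_onI[OF assms]])
  ultimately show ?thesis by (rule P.integrable_const_bound)
qed

text \<open>
  The iterate \<open>xi k\<close> and the remaining samples of its batch are functions of \<open>others (k, j)\<close>, hence
  independent of sample \<open>(k, j)\<close>.
\<close>
definition "others i s = (\<lambda>i'\<in>sample_index - {i}. \<xi> i' s)"

lemma others_measurable: "others i \<in> P \<rightarrow>\<^sub>M PiM (sample_index - {i}) (\<lambda>_. borel \<Otimes>\<^sub>M M)"
  unfolding others_def[abs_def] by (intro measurable_restrict \<xi>_measurable) auto

text \<open>By independence the joint law of \<open>others i\<close> and \<open>\<xi> i\<close> is a
  product, so sample \<open>i\<close> can be integrated out first with everything else frozen. This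
  replaces conditioning on the past, and it freezes the remaining samples of the same batch as
  well.\<close>

lemma fubini_sample:
  fixes f :: "(nat \<times> nat \<Rightarrow> (real^'n) \<times> 'w) \<times> ((real^'n) \<times> 'w) \<Rightarrow> real"
  assumes i: "i \<in> sample_index"
    and f [measurable]: "f \<in> borel_measurable (PiM (sample_index - {i}) (\<lambda>_. borel \<Otimes>\<^sub>M M) \<Otimes>\<^sub>M (borel \<Otimes>\<^sub>M M))"
    and int: "integrable P (\<lambda>s. f (others i s, \<xi> i s))"
  shows "P.expectation (\<lambda>s. f (others i s, \<xi> i s)) = P.expectation (\<lambda>s. LINT p|sample_law. f (others i s, p))"
    and "integrable P (\<lambda>s. LINT p|sample_law. f (others i s, p))"
proof -
  let ?A = "PiM (sample_index - {i}) (\<lambda>_. borel \<Otimes>\<^sub>M M :: ((real^'n) \<times> 'w) measure)"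
  let ?B = "PiM {i} (\<lambda>_. borel \<Otimes>\<^sub>M M :: ((real^'n) \<times> 'w) measure)"
  \<comment> \<open>Restricting an independent family to disjoint index sets yields variables in
    product spaces, so the single sample is wrapped as a function on \<open>{i}\<close> and
    recovered by evaluation at \<open>i\<close>.\<close>
  define V where "V s = (\<lambda>i'\<in>{i}. \<xi> i' s)" for s
  note [measurable] = others_measurable[of i]
  have V [measurable]: "V \<in> P \<rightarrow>\<^sub>M ?B"
    unfolding V_def[abs_def] using i by (intro measurable_restrict \<xi>_measurable) auto
  have comp [measurable]: "(\<lambda>\<omega>. \<omega> i) \<in> ?B \<rightarrow>\<^sub>M borel \<Otimes>\<^sub>M M"
    by (rule measurable_component_singleton) simp
  have fV [measurable]: "(\<lambda>q. f (fst q, snd q i)) \<in> borel_measurable (?A \<Otimes>\<^sub>M ?B)"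
    by measurable
  have "P.indep_var ?A (others i) ?B V"
    unfolding others_def[abs_def] V_def[abs_def] using i
    by (intro P.indep_var_restrict[OF \<xi>_indep]) auto
  then have joint: "distr P (?A \<Otimes>\<^sub>M ?B) (\<lambda>s. (others i s, V s)) = distr P ?A (others i) \<Otimes>\<^sub>M distr P ?B V"
    by (simp add: P.indep_var_distribution_eq)
  interpret A: prob_space "distr P ?A (others i)" by (rule P.prob_space_distr) measurable
  interpret B: prob_space "distr P ?B V" by (rule P.prob_space_distr) measurable
  interpret AB: pair_prob_space "distr P ?A (others i)" "distr P ?B V" ..
  have V_i: "V s i = \<xi> i s" for s by (simp add: V_def)
  have inner: "(LINT w|distr P ?B V. f (\<omega>, w i)) = (LINT p|sample_law. f (\<omega>, p))" if "\<omega> \<in> space ?A" for \<omega>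
  proof -
    note [measurable] = \<xi>_measurable[OF i]
    have [measurable]: "(\<lambda>p. f (\<omega>, p)) \<in> borel_measurable (borel \<Otimes>\<^sub>M M)"
      by (rule measurable_Pair2[OF f that])
    have "(LINT w|distr P ?B V. f (\<omega>, w i)) = P.expectation (\<lambda>s. f (\<omega>, \<xi> i s))"
      by (subst integral_distr) (auto simp: V_i)
    also have "\<dots> = (LINT p|distr P (borel \<Otimes>\<^sub>M M) (\<xi> i). f (\<omega>, p))"
      by (subst integral_distr) auto
    finally show ?thesis unfolding \<xi>_law[OF i] .
  qed
  have "integrable (distr P (?A \<Otimes>\<^sub>M ?B) (\<lambda>s. (others i s, V s))) (\<lambda>q. f (fst q, snd q i))"
    using int by (subst integrable_distr_eq) (auto simp: V_i)
  then have int': "integrable (distr P ?A (others i) \<Otimes>\<^sub>M distr P ?B V) (\<lambda>q. f (fst q, snd q i))"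
    unfolding joint .
  have "integrable (distr P ?A (others i)) (\<lambda>\<omega>. LINT w|distr P ?B V. f (\<omega>, w i))"
    using AB.integrable_fst'[OF int'] by simp
  then have int_out: "integrable (distr P ?A (others i)) (\<lambda>\<omega>. LINT p|sample_law. f (\<omega>, p))"
    by (subst (asm) Bochner_Integration.integrable_cong[OF refl inner]) auto
  then have [measurable]: "(\<lambda>\<omega>. LINT p|sample_law. f (\<omega>, p)) \<in> borel_measurable ?A"
    using borel_measurable_integrable by fastforce
  from int_out show "integrable P (\<lambda>s. LINT p|sample_law. f (others i s, p))"
    by (subst (asm) integrable_distr_eq) auto
  have "P.expectation (\<lambda>s. f (others i s, \<xi> i s)) =
      (LINT q|distr P (?A \<Otimes>\<^sub>M ?B) (\<lambda>s. (others i s, V s)). f (fst q, snd q i))"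
    by (subst integral_distr) (auto simp: V_i)
  also have "\<dots> = (LINT \<omega>|distr P ?A (others i). LINT w|distr P ?B V. f (\<omega>, w i))"
    unfolding joint using AB.integral_fst'[OF int'] by simp
  also have "\<dots> = (LINT \<omega>|distr P ?A (others i). LINT p|sample_law. f (\<omega>, p))"
    by (intro Bochner_Integration.integral_cong refl inner) simp
  also have "\<dots> = P.expectation (\<lambda>s. LINT p|sample_law. f (others i s, p))"
    by (rule integral_distr) measurable
  finally show "P.expectation (\<lambda>s. f (others i s, \<xi> i s)) = P.expectation (\<lambda>s. LINT p|sample_law. f (others i s, p))" .
qed

lemma iter_others: "iter k (others (k, j) s) = xi k s"
  unfolding xi_def by (rule iter_cong) (auto simp: others_def samples_def)

section \<open>Mean square error of a batch\<close>

definition "noise k j s = g (xi k s) (\<xi> (k, j) s) - grad (xi k s)"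

lemma noise_measurable:
  assumes "(k, j) \<in> sample_index"
  shows "noise k j \<in> borel_measurable P"
  unfolding noise_def[abs_def]
  by (intro borel_measurable_diff g_comp_measurable xi_measurable \<xi>_measurable[OF assms]
      measurable_compose[OF xi_measurable grad_measurable])

text \<open>Integrability has to come from domination, since \<open>fubini_sample\<close>
  presupposes it. The bound on \<open>g\<close> is uniform in its base point, so it survives
  substitution of the random iterate.\<close>

lemma noise_square_integrable:
  assumes i: "(k, j) \<in> sample_index"
  shows "integrable P (\<lambda>s. (norm (noise k j s))\<^sup>2)"
proof (rule Bochner_Integration.integrable_bound)
  note [measurable] = \<xi>_measurable[OF i]
  have "integrable (distr P (borel \<Otimes>\<^sub>M M) (\<xi> (k, j))) (\<lambda>p. (\<Lambda> (snd p))\<^sup>2)"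
    unfolding \<xi>_law[OF i] by (rule \<Lambda>_sample_law)
  then have "integrable P (\<lambda>s. (\<Lambda> (snd (\<xi> (k, j) s)))\<^sup>2)"
    by (subst (asm) integrable_distr_eq) auto
  then show "integrable P (\<lambda>s. 2 * ((real CARD('n))\<^sup>2 * (\<Lambda> (snd (\<xi> (k, j) s)))\<^sup>2) + 2 * (real CARD('n) * L)\<^sup>2)"
    by simp
  have "AE p in distr P (borel \<Otimes>\<^sub>M M) (\<xi> (k, j)). \<forall>z. norm (g z p) \<le> real CARD('n) * \<Lambda> (snd p)"
    unfolding \<xi>_law[OF i] by (rule AE_norm_g_le)
  then have "AE s in P. \<forall>z. norm (g z (\<xi> (k, j) s)) \<le> real CARD('n) * \<Lambda> (snd (\<xi> (k, j) s))"
    by (rule AE_distrD[rotated]) measurable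
  then show "AE s in P. norm ((norm (noise k j s))\<^sup>2) \<le>
      norm (2 * ((real CARD('n))\<^sup>2 * (\<Lambda> (snd (\<xi> (k, j) s)))\<^sup>2) + 2 * (real CARD('n) * L)\<^sup>2)"
  proof eventually_elim
    case (elim s)
    have "norm (noise k j s) \<le> norm (g (xi k s) (\<xi> (k, j) s)) + norm (grad (xi k s))"
      unfolding noise_def by (rule norm_triangle_ineq4)
    also have "\<dots> \<le> real CARD('n) * \<Lambda> (snd (\<xi> (k, j) s)) + real CARD('n) * L"
      by (intro add_mono elim[rule_format] norm_grad_le)
    finally have "(norm (noise k j s))\<^sup>2 \<le> (real CARD('n) * \<Lambda> (snd (\<xi> (k, j) s)) + real CARD('n) * L)\<^sup>2"
      by (intro power_mono) auto
    also have "\<dots> \<le> 2 * ((real CARD('n))\<^sup>2 * (\<Lambda> (snd (\<xi> (k, j) s)))\<^sup>2) + 2 * (real CARD('n) * L)\<^sup>2"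
      using sum_squares_bound[of "real CARD('n) * \<Lambda> (snd (\<xi> (k, j) s))" "real CARD('n) * L"]
      unfolding power2_sum power_mult_distrib by linarith
    finally show ?case by simp
  qed
qed (use noise_measurable[OF i] in simp)

lemma noise_second_moment:
  assumes i: "(k, j) \<in> sample_index"
  shows "P.expectation (\<lambda>s. (norm (noise k j s))\<^sup>2) \<le> (real CARD('n))\<^sup>2 * L\<^sup>2"
proof -
  define f where "f q = (norm (g (iter k (fst q)) (snd q) - grad (iter k (fst q))))\<^sup>2" for q
  have [measurable]: "iter k \<in> borel_measurable (PiM (sample_index - {(k, j)}) (\<lambda>_. borel \<Otimes>\<^sub>M M))"
    by (rule iter_measurable) auto
  have [measurable]: "(\<lambda>q. g (iter k (fst q)) (snd q)) \<in>
      borel_measurable (PiM (sample_index - {(k, j)}) (\<lambda>_. borel \<Otimes>\<^sub>M M) \<Otimes>\<^sub>M (borel \<Otimes>\<^sub>M M))"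
    by (rule g_comp_measurable) measurable
  have f_meas: "f \<in> borel_measurable (PiM (sample_index - {(k, j)}) (\<lambda>_. borel \<Otimes>\<^sub>M M) \<Otimes>\<^sub>M (borel \<Otimes>\<^sub>M M))"
    unfolding f_def by measurable
  have f_eq: "f (others (k, j) s, \<xi> (k, j) s) = (norm (noise k j s))\<^sup>2" for s
    by (simp add: f_def noise_def iter_others)
  have int: "integrable P (\<lambda>s. f (others (k, j) s, \<xi> (k, j) s))"
    unfolding f_eq by (rule noise_square_integrable[OF i])
  have "P.expectation (\<lambda>s. (norm (noise k j s))\<^sup>2) = P.expectation (\<lambda>s. LINT p|sample_law. f (others (k, j) s, p))"
    using fubini_sample(1)[OF i f_meas int] by (simp only: f_eq)
  also have "\<dots> \<le> P.expectation (\<lambda>s. (real CARD('n))\<^sup>2 * L\<^sup>2)"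
    using g_variance(2) by (intro integral_mono fubini_sample(2)[OF i f_meas int]) (auto simp: f_def)
  finally show ?thesis using P.prob_space by simp
qed

lemma noise_inner_integrable:
  assumes "(k, i) \<in> sample_index" "(k, j) \<in> sample_index"
  shows "integrable P (\<lambda>s. noise k i s \<bullet> noise k j s)"
proof (rule Bochner_Integration.integrable_bound)
  show "integrable P (\<lambda>s. (norm (noise k i s))\<^sup>2 + (norm (noise k j s))\<^sup>2)"
    using noise_square_integrable assms by simp
  show "AE s in P. norm (noise k i s \<bullet> noise k j s) \<le> norm ((norm (noise k i s))\<^sup>2 + (norm (noise k j s))\<^sup>2)"
    using inner_abs_le_squares by (intro AE_I2) (simp add: abs_of_nonneg)
qed (use noise_measurable assms in simp)

lemma noise_orthogonal:
  assumes i: "(k, i) \<in> sample_index" and j: "(k, j) \<in> sample_index" and "i \<noteq> j"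
  shows "P.expectation (\<lambda>s. noise k i s \<bullet> noise k j s) = 0"
proof -
  let ?A = "PiM (sample_index - {(k, j)}) (\<lambda>_. borel \<Otimes>\<^sub>M M :: ((real^'n) \<times> 'w) measure)"
  define f where "f q = (g (iter k (fst q)) (fst q (k, i)) - grad (iter k (fst q))) \<bullet>
    (g (iter k (fst q)) (snd q) - grad (iter k (fst q)))" for q
  have [measurable]: "iter k \<in> borel_measurable ?A"
    by (rule iter_measurable) auto
  have [measurable]: "(\<lambda>\<omega>. \<omega> (k, i)) \<in> ?A \<rightarrow>\<^sub>M borel \<Otimes>\<^sub>M M"
    using i \<open>i \<noteq> j\<close> by (intro measurable_component_singleton) auto
  have [measurable]: "(\<lambda>q. g (iter k (fst q)) (snd q)) \<in> borel_measurable (?A \<Otimes>\<^sub>M (borel \<Otimes>\<^sub>M M))"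
    by (rule g_comp_measurable) measurable
  have [measurable]: "(\<lambda>q. g (iter k (fst q)) (fst q (k, i))) \<in> borel_measurable (?A \<Otimes>\<^sub>M (borel \<Otimes>\<^sub>M M))"
    by (rule g_comp_measurable) measurable
  have f_meas: "f \<in> borel_measurable (?A \<Otimes>\<^sub>M (borel \<Otimes>\<^sub>M M))"
    unfolding f_def by measurable
  have f_eq: "f (others (k, j) s, \<xi> (k, j) s) = noise k i s \<bullet> noise k j s" for s
  proof -
    have "others (k, j) s (k, i) = \<xi> (k, i) s"
      using i \<open>i \<noteq> j\<close> by (simp add: others_def)
    then show ?thesis by (simp add: f_def noise_def iter_others)
  qed
  have int: "integrable P (\<lambda>s. f (others (k, j) s, \<xi> (k, j) s))"
    unfolding f_eq by (rule noise_inner_integrable[OF i j])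
  interpret S: prob_space sample_law by (rule sample_law_prob_space)
  have "(LINT p|sample_law. f (\<omega>, p)) = 0" for \<omega>
  proof -
    have "(LINT p|sample_law. g (iter k \<omega>) p - grad (iter k \<omega>)) = 0"
      using g_integrable S.prob_space by (simp add: expectation_g)
    then show ?thesis
      unfolding f_def fst_conv snd_conv using g_integrable
      by (subst integral_inner_right) auto
  qed
  then show ?thesis
    using fubini_sample(1)[OF j f_meas int] by (simp add: f_eq)
qed

definition "error k s = batch_gradient k (xi k s) (samples s) - grad (xi k s)"

lemma error_eq: "error k s = (1 / real (batch_size k)) *\<^sub>R (\<Sum>j = 1..batch_size k. noise k j s)"
proof -
  have "(\<Sum>j = 1..batch_size k. g (xi k s) (samples s (k, j))) = (\<Sum>j = 1..batch_size k. g (xi k s) (\<xi> (k, j) s))"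
    by (intro sum.cong) (auto simp: samples_def sample_index_def)
  moreover have "real (batch_size k) \<noteq> 0" by (simp add: batch_size_def)
  ultimately show ?thesis
    by (simp add: error_def batch_gradient_def noise_def sum_subtractf scaleR_diff_right
        sum_constant_scaleR del: sum_constant)
qed

lemma norm_error_square:
  "(norm (error k s))\<^sup>2 = (1 / real (batch_size k))\<^sup>2 *
    (\<Sum>i = 1..batch_size k. \<Sum>j = 1..batch_size k. noise k i s \<bullet> noise k j s)"
proof -
  have "(norm (\<Sum>j = 1..batch_size k. noise k j s))\<^sup>2 =
      (\<Sum>i = 1..batch_size k. \<Sum>j = 1..batch_size k. noise k i s \<bullet> noise k j s)"
    unfolding power2_norm_eq_inner by (subst inner_sum_left) (simp only: inner_sum_right)
  then show ?thesis
    unfolding error_eq norm_scaleR power_mult_distrib by simp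
qed

lemma in_sample_index: "j \<in> {1..batch_size k} \<Longrightarrow> (k, j) \<in> sample_index"
  by (simp add: sample_index_def)

lemma error_square_integrable: "integrable P (\<lambda>s. (norm (error k s))\<^sup>2)"
  unfolding norm_error_square
  by (intro integrable_mult_right Bochner_Integration.integrable_sum noise_inner_integrable in_sample_index)

lemma error_second_moment:
  "P.expectation (\<lambda>s. (norm (error k s))\<^sup>2) \<le> (real CARD('n))\<^sup>2 * L\<^sup>2 / real (k + 1)"
proof -
  have "P.expectation (\<lambda>s. \<Sum>i = 1..batch_size k. \<Sum>j = 1..batch_size k. noise k i s \<bullet> noise k j s) =
      (\<Sum>i = 1..batch_size k. P.expectation (\<lambda>s. \<Sum>j = 1..batch_size k. noise k i s \<bullet> noise k j s))"
    by (rule Bochner_Integration.integral_sum)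
      (intro Bochner_Integration.integrable_sum noise_inner_integrable in_sample_index)
  also have "\<dots> = (\<Sum>i = 1..batch_size k. \<Sum>j = 1..batch_size k. P.expectation (\<lambda>s. noise k i s \<bullet> noise k j s))"
    by (intro sum.cong refl Bochner_Integration.integral_sum noise_inner_integrable in_sample_index)
  finally have "P.expectation (\<lambda>s. (norm (error k s))\<^sup>2) = (1 / real (batch_size k))\<^sup>2 *
      (\<Sum>i = 1..batch_size k. \<Sum>j = 1..batch_size k. P.expectation (\<lambda>s. noise k i s \<bullet> noise k j s))"
    unfolding norm_error_square integral_mult_right_zero by (rule arg_cong)
  also have "(\<Sum>i = 1..batch_size k. \<Sum>j = 1..batch_size k. P.expectation (\<lambda>s. noise k i s \<bullet> noise k j s)) =
      (\<Sum>i = 1..batch_size k. P.expectation (\<lambda>s. (norm (noise k i s))\<^sup>2))"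
  proof (rule sum.cong[OF refl])
    fix i assume i: "i \<in> {1..batch_size k}"
    have "(\<Sum>j = 1..batch_size k. P.expectation (\<lambda>s. noise k i s \<bullet> noise k j s)) =
        (\<Sum>j\<in>{i}. P.expectation (\<lambda>s. noise k i s \<bullet> noise k j s))"
      using i by (intro sum.mono_neutral_right) (auto intro!: noise_orthogonal in_sample_index)
    then show "(\<Sum>j = 1..batch_size k. P.expectation (\<lambda>s. noise k i s \<bullet> noise k j s)) =
        P.expectation (\<lambda>s. (norm (noise k i s))\<^sup>2)"
      by (simp add: power2_norm_eq_inner)
  qed
  also have "\<dots> \<le> (\<Sum>i = 1..batch_size k. (real CARD('n))\<^sup>2 * L\<^sup>2)"
    by (intro sum_mono noise_second_moment in_sample_index)
  also have "(1 / real (batch_size k))\<^sup>2 * \<dots> = (real CARD('n))\<^sup>2 * L\<^sup>2 / real (k + 1)"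
    by (simp add: batch_size_def power2_eq_square)
  finally show ?thesis by (simp add: mult_left_mono)
qed

section \<open>Telescoped descent and the random output index\<close>

definition "stationarity z = (norm ((1 / \<gamma>) *\<^sub>R (z - closest_point X (z - \<gamma> *\<^sub>R grad z))))\<^sup>2"

lemma grad_continuous: "continuous_on UNIV grad"
  using grad_lipschitz by (rule lipschitz_on_continuous_on)

lemma stationarity_continuous: "continuous_on UNIV stationarity"
  unfolding stationarity_def[abs_def] using X X_ne
  by (intro continuous_intros continuous_on_compose2[OF continuous_on_closest_point[of X UNIV]] grad_continuous) auto

lemma stationarity_nonneg: "0 \<le> stationarity z"
  by (simp add: stationarity_def)

text \<open>A point of \<open>X\<close> is its own projection, so nonexpansiveness bounds the
  residual by the gradient. The bound makes Fubini applicable to the random output index, and it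
  settles the complexity claim when \<epsilon> is large.\<close>

lemma stationarity_le:
  assumes "z \<in> X"
  shows "stationarity z \<le> (real CARD('n))\<^sup>2 * L\<^sup>2"
proof -
  have "norm (z - closest_point X (z - \<gamma> *\<^sub>R grad z)) =
      dist (closest_point X z) (closest_point X (z - \<gamma> *\<^sub>R grad z))"
    using assms by (simp add: dist_norm closest_point_self)
  also have "\<dots> \<le> dist z (z - \<gamma> *\<^sub>R grad z)"
    using X X_ne by (intro closest_point_lipschitz)
  also have "\<dots> = \<gamma> * norm (grad z)" using \<gamma>_pos by (simp add: dist_norm)
  finally have "norm ((1 / \<gamma>) *\<^sub>R (z - closest_point X (z - \<gamma> *\<^sub>R grad z))) \<le> norm (grad z)"
    using \<gamma>_pos unfolding norm_scaleR by (simp add: divide_le_eq mult.commute)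
  also have "\<dots> \<le> real CARD('n) * L" by (rule norm_grad_le)
  finally have "stationarity z \<le> (real CARD('n) * L)\<^sup>2"
    unfolding stationarity_def by (intro power_mono) auto
  then show ?thesis by (simp add: power_mult_distrib)
qed

lemma integrable_stationarity: "integrable P (\<lambda>s. stationarity (xi k s))"
  by (rule integrable_xi[OF stationarity_continuous])

lemma integrable_smoothing: "integrable P (\<lambda>s. smoothing \<eta> H_mean (xi k s))"
proof (rule integrable_xi)
  show "continuous_on UNIV (smoothing \<eta> H_mean)"
    using smoothing_has_derivative has_derivative_continuous
    by (metis continuous_at_imp_continuous_on)
qed

lemma xi_Suc: "xi (Suc k) s = closest_point X (xi k s - \<gamma> *\<^sub>R batch_gradient k (xi k s) (samples s))"
  by (simp add: xi_def)

lemma expected_descent: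
  assumes "real CARD('n) * L / \<eta> * \<gamma> \<le> 1"
  shows "\<gamma> / 4 * (1 - real CARD('n) * L / \<eta> * \<gamma>) * P.expectation (\<lambda>s. stationarity (xi k s)) \<le>
    P.expectation (\<lambda>s. smoothing \<eta> H_mean (xi k s)) - P.expectation (\<lambda>s. smoothing \<eta> H_mean (xi (Suc k) s))
    + \<gamma> * (1 - real CARD('n) * L / \<eta> * \<gamma> / 2) * ((real CARD('n))\<^sup>2 * L\<^sup>2 / real (k + 1))"
proof -
  define c where "c = \<gamma> / 4 * (1 - real CARD('n) * L / \<eta> * \<gamma>)"
  define d where "d = \<gamma> * (1 - real CARD('n) * L / \<eta> * \<gamma> / 2)"
  have "0 \<le> 1 - a / 2" if "a \<le> 1" for a :: real using that by simp
  from this[OF assms] have "0 \<le> d" using \<gamma>_pos unfolding d_def by (intro mult_nonneg_nonneg) auto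
  have "c * stationarity (xi k s) \<le> smoothing \<eta> H_mean (xi k s) - smoothing \<eta> H_mean (xi (Suc k) s)
      + d * (norm (error k s))\<^sup>2" for s
    using projected_step_descent[OF smoothing_has_derivative grad_lipschitz X(1,2) xi_in_X \<gamma>_pos assms,
        of k s "batch_gradient k (xi k s) (samples s)"]
    unfolding xi_Suc stationarity_def error_def c_def d_def by linarith
  then have "P.expectation (\<lambda>s. c * stationarity (xi k s)) \<le> P.expectation (\<lambda>s. smoothing \<eta> H_mean (xi k s)
      - smoothing \<eta> H_mean (xi (Suc k) s) + d * (norm (error k s))\<^sup>2)"
    by (intro integral_mono integrable_mult_right Bochner_Integration.integrable_add
        Bochner_Integration.integrable_diff integrable_stationarity integrable_smoothing error_square_integrable)
  also have "\<dots> = P.expectation (\<lambda>s. smoothing \<eta> H_mean (xi k s)) - P.expectation (\<lambda>s. smoothing \<eta> H_mean (xi (Suc k) s))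
      + d * P.expectation (\<lambda>s. (norm (error k s))\<^sup>2)"
    by (simp add: integrable_smoothing error_square_integrable)
  also have "d * P.expectation (\<lambda>s. (norm (error k s))\<^sup>2) \<le> d * ((real CARD('n))\<^sup>2 * L\<^sup>2 / real (k + 1))"
    by (intro mult_left_mono error_second_moment \<open>0 \<le> d\<close>)
  finally show ?thesis by (simp add: c_def d_def)
qed

text \<open>The telescoping concerns the smoothed objective. Returning to \<open>H_mean\<close>
  costs \<open>L * \<eta>\<close> at each end, which is the origin of
  \<open>2 * L * \<eta>\<close>.\<close>

lemma sum_stationarity_le:
  assumes "real CARD('n) * L / \<eta> * \<gamma> \<le> 1" "l \<le> K" "\<And>z. z \<in> X \<Longrightarrow> m \<le> H_mean z"
  shows "\<gamma> / 4 * (1 - real CARD('n) * L / \<eta> * \<gamma>) * (\<Sum>k = l..K. P.expectation (\<lambda>s. stationarity (xi k s))) \<le>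
    P.expectation (\<lambda>s. H_mean (xi l s)) - m + 2 * L * \<eta>
    + \<gamma> * (1 - real CARD('n) * L / \<eta> * \<gamma> / 2) * ((real CARD('n))\<^sup>2 * L\<^sup>2 * (\<Sum>k = l..K. 1 / real (k + 1)))"
proof -
  define \<phi> where "\<phi> k = P.expectation (\<lambda>s. smoothing \<eta> H_mean (xi k s))" for k
  have H_int: "integrable P (\<lambda>s. H_mean (xi k s))" for k
    using H_mean_lipschitz by (intro integrable_xi lipschitz_on_continuous_on)
  have close: "\<bar>smoothing \<eta> H_mean z - H_mean z\<bar> \<le> L * \<eta>" for z
    by (rule smoothing_close[OF H_mean_lipschitz \<eta>_pos])
  have "\<phi> l \<le> P.expectation (\<lambda>s. H_mean (xi l s) + L * \<eta>)"
    unfolding \<phi>_def using close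
    by (intro integral_mono integrable_smoothing Bochner_Integration.integrable_add H_int) (auto simp: abs_le_iff algebra_simps)
  then have up: "\<phi> l \<le> P.expectation (\<lambda>s. H_mean (xi l s)) + L * \<eta>"
    using H_int P.prob_space by simp
  have "P.expectation (\<lambda>s. m - L * \<eta>) \<le> \<phi> (Suc K)"
    unfolding \<phi>_def
  proof (intro integral_mono integrable_smoothing)
    show "m - L * \<eta> \<le> smoothing \<eta> H_mean (xi (Suc K) s)" for s
      using close[of "xi (Suc K) s"] assms(3)[OF xi_in_X, of "Suc K" s] by (auto simp: abs_le_iff)
  qed simp
  then have low: "m - L * \<eta> \<le> \<phi> (Suc K)" using P.prob_space by simp
  have "\<gamma> / 4 * (1 - real CARD('n) * L / \<eta> * \<gamma>) * (\<Sum>k = l..K. P.expectation (\<lambda>s. stationarity (xi k s))) \<le>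
     (\<Sum>k = l..K. \<phi> k - \<phi> (Suc k)
       + \<gamma> * (1 - real CARD('n) * L / \<eta> * \<gamma> / 2) * ((real CARD('n))\<^sup>2 * L\<^sup>2 / real (k + 1)))"
    unfolding sum_distrib_left \<phi>_def by (intro sum_mono expected_descent assms(1))
  also have "\<dots> = \<phi> l - \<phi> (Suc K)
    + \<gamma> * (1 - real CARD('n) * L / \<eta> * \<gamma> / 2) * ((real CARD('n))\<^sup>2 * L\<^sup>2 * (\<Sum>k = l..K. 1 / real (k + 1)))"
  proof -
    have "(\<Sum>k = l..K. \<phi> k - \<phi> (Suc k)) = \<phi> l - \<phi> (Suc K)"
      using sum_Suc_diff'[of l "Suc K" "\<lambda>k. - \<phi> k"] assms(2) by (simp add: atLeastLessThanSuc_atLeastAtMost)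
    then show ?thesis by (simp add: sum.distrib sum_distrib_left)
  qed
  finally show ?thesis using up low by linarith
qed

text \<open>The iterates are functions of the sample table, which is independent of
  \<open>R\<close>; integrating over the table first leaves a plain average over the index.\<close>

lemma expectation_random_index:
  assumes R_law: "distr P (count_space UNIV) R = measure_pmf (pmf_of_set {l..K})" and "l \<le> K"
    and R_indep: "indep_rv P (count_space UNIV) R (PiM sample_index (\<lambda>_. borel \<Otimes>\<^sub>M M)) samples"
  shows "P.expectation (\<lambda>s. stationarity (xi (R s) s)) =
    (\<Sum>k = l..K. P.expectation (\<lambda>s. stationarity (xi k s))) / real (card {l..K})"
proof -
  let ?C = "count_space (UNIV :: nat set)"
  let ?Q = "PiM sample_index (\<lambda>_. borel \<Otimes>\<^sub>M M :: ((real^'n) \<times> 'w) measure)"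
  have [measurable]: "R \<in> P \<rightarrow>\<^sub>M ?C"
    and joint: "distr P (?C \<Otimes>\<^sub>M ?Q) (\<lambda>s. (R s, samples s)) = distr P ?C R \<Otimes>\<^sub>M distr P ?Q samples"
    using R_indep by (auto simp: indep_rv_def)
  have [measurable]: "stationarity \<in> borel_measurable borel"
    by (rule borel_measurable_continuous_onI[OF stationarity_continuous])
  have [measurable]: "iter k \<in> borel_measurable ?Q" for k by (rule iter_measurable)
  define f where "f q = stationarity (iter (fst q) (snd q))" for q
  have f [measurable]: "f \<in> borel_measurable (?C \<Otimes>\<^sub>M ?Q)"
    unfolding f_def[abs_def] by (rule measurable_pair_measure_countable1) auto
  interpret A: prob_space "distr P ?C R" by (rule P.prob_space_distr) measurable
  interpret B: prob_space "distr P ?Q samples" by (rule P.prob_space_distr) measurable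
  interpret AB: pair_prob_space "distr P ?C R" "distr P ?Q samples" ..
  have bound: "\<bar>f q\<bar> \<le> (real CARD('n))\<^sup>2 * L\<^sup>2" for q
    unfolding f_def using stationarity_le[OF iter_in_X] by (simp add: stationarity_nonneg)
  have int: "integrable (distr P ?C R \<Otimes>\<^sub>M distr P ?Q samples) f"
    by (rule AB.P.integrable_const_bound[where B = "(real CARD('n))\<^sup>2 * L\<^sup>2"]) (use bound in auto)
  have "P.expectation (\<lambda>s. stationarity (xi (R s) s)) = (LINT q|distr P (?C \<Otimes>\<^sub>M ?Q) (\<lambda>s. (R s, samples s)). f q)"
    by (subst integral_distr) (auto simp: f_def xi_def)
  also have "\<dots> = (LINT k|distr P ?C R. LINT \<omega>|distr P ?Q samples. f (k, \<omega>))"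
    unfolding joint by (rule AB.integral_fst'[OF int, symmetric])
  also have "\<dots> = (LINT k|distr P ?C R. P.expectation (\<lambda>s. stationarity (xi k s)))"
    by (intro Bochner_Integration.integral_cong refl, subst integral_distr) (auto simp: f_def xi_def)
  also have "\<dots> = (\<Sum>k = l..K. P.expectation (\<lambda>s. stationarity (xi k s))) / real (card {l..K})"
    unfolding R_law using \<open>l \<le> K\<close> by (subst integral_pmf_of_set) auto
  finally show ?thesis .
qed

end

section \<open>Rates\<close>

text \<open>Each new term is absorbed by a difference of logarithms, from
  \<open>ln t \<le> t - 1\<close> at \<open>t = (K + 1) / (K + 2)\<close>. Keeping the first term
  apart yields a quotient with both indices raised by one, which can later be compared with
  \<open>1 / lam\<close>.\<close>

lemma sum_inverse_le_ln:
  assumes "l \<le> K"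
  shows "(\<Sum>k = l..K. 1 / real (k + 1)) \<le> 1 / real (l + 1) + ln (real (K + 1) / real (l + 1))"
  using assms
proof (induction K rule: dec_induct)
  case (step K)
  have "ln (real (K + 1) / real (K + 2)) \<le> real (K + 1) / real (K + 2) - 1"
    by (rule ln_le_minus_one) simp
  also have "\<dots> = - (1 / real (K + 2))" by (simp add: field_simps)
  finally have "1 / real (K + 2) \<le> ln (real (K + 2)) - ln (real (K + 1))"
    by (simp add: ln_div)
  moreover have "(\<Sum>k = l..Suc K. 1 / real (k + 1)) = (\<Sum>k = l..K. 1 / real (k + 1)) + 1 / real (K + 2)"
    using step.hyps by (simp add: sum.atLeast_Suc_atMost_Suc_shift del: of_nat_add)
  ultimately show ?case
    using step.IH by (simp add: ln_div)
qed simp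

text \<open>Rounding up moves \<open>l\<close> by less than 1, and the extra element of a closed
  integer interval compensates for it in the cardinality. Since \<open>l \<ge> 1\<close>, the first
  term of the sum is at most \<open>1 / 2\<close>; since \<open>lam < 1\<close>,
  \<open>lam * (K + 1) \<le> l + 1\<close>, which gives \<open>- ln lam\<close>.\<close>

lemma
  fixes lam :: real
  assumes lam: "0 < lam" "lam < 1" and K: "0 < K" and l: "l = nat \<lceil>lam * real K\<rceil>"
  shows ceiling_fraction_le: "l \<le> K"
    and card_tail_ge: "(1 - lam) * real K \<le> real (card {l..K})"
    and sum_inverse_tail_le: "(\<Sum>k = l..K. 1 / real (k + 1)) \<le> 1 / 2 - ln lam"
proof -
  have pos: "0 < lam * real K" using lam K by simp
  have le: "lam * real K \<le> real l" and less: "real l < lam * real K + 1"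
    unfolding l using pos ceiling_correct[of "lam * real K"] by linarith+
  have "lam * real K < real K" using lam K by simp
  then have "real l < real K + 1" using less by linarith
  then show lK: "l \<le> K" by linarith
  then show "(1 - lam) * real K \<le> real (card {l..K})"
    using less by (simp add: of_nat_diff algebra_simps)
  have "1 \<le> l" using pos le by linarith
  then have "1 / real (l + 1) \<le> 1 / 2" by (simp add: field_simps)
  moreover have "real (K + 1) / real (l + 1) \<le> 1 / lam"
  proof -
    have "lam * real (K + 1) \<le> real (l + 1)" using le lam by (simp add: algebra_simps)
    then show ?thesis using lam by (simp add: field_simps)
  qed
  then have "ln (real (K + 1) / real (l + 1)) \<le> ln (1 / lam)"
    using lam by (intro ln_mono) auto
  then have "ln (real (K + 1) / real (l + 1)) \<le> - ln lam" using lam by (simp add: ln_div)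
  ultimately show "(\<Sum>k = l..K. 1 / real (k + 1)) \<le> 1 / 2 - ln lam"
    using sum_inverse_le_ln[OF lK] by linarith
qed

lemma (in zo_scheme) expected_stationarity_le:
  assumes lam: "0 < lam" "lam < 1" and K: "0 < K" and l: "l = nat \<lceil>lam * real K\<rceil>"
    and step: "\<gamma> < \<eta> / (real CARD('n) * L)" and m: "\<And>z. z \<in> X \<Longrightarrow> m \<le> H_mean z"
    and R_law: "distr P (count_space UNIV) R = measure_pmf (pmf_of_set {l..K})"
    and R_indep: "indep_rv P (count_space UNIV) R (PiM sample_index (\<lambda>_. borel \<Otimes>\<^sub>M M)) samples"
  shows "P.expectation (\<lambda>s. stationarity (xi (R s) s)) \<le>
    ((real CARD('n))\<^sup>2 * L\<^sup>2 * \<gamma> * (0.5 - ln lam) * (1 - real CARD('n) * L * \<gamma> / (2 * \<eta>))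
      + P.expectation (\<lambda>s. H_mean (xi l s)) - m + 2 * L * \<eta>)
    / ((1 - real CARD('n) * L * \<gamma> / \<eta>) * (\<gamma> / 4) * (1 - lam) * real K)"
proof -
  define q where "q = real CARD('n) * L / \<eta> * \<gamma>"
  \<comment> \<open>For \<open>L = 0\<close> the stepsize bound would be a division by zero, hence
    0, contradicting \<open>0 < \<gamma>\<close>.\<close>
  have "L \<noteq> 0" using step \<gamma>_pos by auto
  then have "0 < real CARD('n) * L" using L_nonneg by simp
  then have q: "q < 1" using step \<eta>_pos by (simp add: q_def field_simps)
  define S where "S = (\<Sum>k = l..K. P.expectation (\<lambda>s. stationarity (xi k s)))"
  have S: "0 \<le> S" unfolding S_def by (intro sum_nonneg Bochner_Integration.integral_nonneg stationarity_nonneg)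
  define W where "W = P.expectation (\<lambda>s. H_mean (xi l s)) - m + 2 * L * \<eta>"
  have lK: "l \<le> K" by (rule ceiling_fraction_le[OF lam K l])
  have "\<gamma> / 4 * (1 - q) * S \<le> W + \<gamma> * (1 - q / 2) * ((real CARD('n))\<^sup>2 * L\<^sup>2 * (\<Sum>k = l..K. 1 / real (k + 1)))"
    unfolding S_def q_def W_def by (rule sum_stationarity_le) (use q lK m in \<open>auto simp: q_def\<close>)
  also have "\<dots> \<le> W + \<gamma> * (1 - q / 2) * ((real CARD('n))\<^sup>2 * L\<^sup>2 * (1 / 2 - ln lam))"
    using q \<gamma>_pos by (intro add_left_mono mult_left_mono sum_inverse_tail_le[OF lam K l] mult_nonneg_nonneg) auto
  finally have main: "\<gamma> / 4 * (1 - q) * S \<le> W + \<gamma> * (1 - q / 2) * ((real CARD('n))\<^sup>2 * L\<^sup>2 * (1 / 2 - ln lam))" .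
  have c: "0 < \<gamma> / 4 * (1 - q)" using q \<gamma>_pos by simp
  have d: "0 < (1 - lam) * real K" using lam K by simp
  have "P.expectation (\<lambda>s. stationarity (xi (R s) s)) = S / real (card {l..K})"
    unfolding S_def by (rule expectation_random_index[OF R_law lK R_indep])
  also have "\<dots> \<le> S / ((1 - lam) * real K)"
    by (rule divide_left_mono[OF card_tail_ge[OF lam K l] S mult_pos_pos[OF _ d]])
      (use d card_tail_ge[OF lam K l] in linarith)
  also have "\<dots> = (\<gamma> / 4 * (1 - q) * S) / (\<gamma> / 4 * (1 - q) * ((1 - lam) * real K))"
    using c by (subst mult_divide_mult_cancel_left) auto
  also have "\<dots> \<le> (W + \<gamma> * (1 - q / 2) * ((real CARD('n))\<^sup>2 * L\<^sup>2 * (1 / 2 - ln lam)))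
      / (\<gamma> / 4 * (1 - q) * ((1 - lam) * real K))"
    using mult_pos_pos[OF c d] by (intro divide_right_mono main) auto
  also have "\<dots> = ((real CARD('n))\<^sup>2 * L\<^sup>2 * \<gamma> * (0.5 - ln lam) * (1 - real CARD('n) * L * \<gamma> / (2 * \<eta>)) + W)
    / ((1 - real CARD('n) * L * \<gamma> / \<eta>) * (\<gamma> / 4) * (1 - lam) * real K)"
  proof (rule arg_cong2[where f = "(/)"])
    have q_alt: "q = real CARD('n) * L * \<gamma> / \<eta>" "q / 2 = real CARD('n) * L * \<gamma> / (2 * \<eta>)"
      by (simp_all add: q_def)
    show "\<gamma> / 4 * (1 - q) * ((1 - lam) * real K) = (1 - real CARD('n) * L * \<gamma> / \<eta>) * (\<gamma> / 4) * (1 - lam) * real K"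
      unfolding q_alt(1)[symmetric] by (simp add: mult_ac)
    show "W + \<gamma> * (1 - q / 2) * ((real CARD('n))\<^sup>2 * L\<^sup>2 * (1 / 2 - ln lam)) =
        (real CARD('n))\<^sup>2 * L\<^sup>2 * \<gamma> * (0.5 - ln lam) * (1 - real CARD('n) * L * \<gamma> / (2 * \<eta>)) + W"
      unfolding q_alt(2)[symmetric] by (simp add: mult_ac)
  qed
  also have "a + W = a + P.expectation (\<lambda>s. H_mean (xi l s)) - m + 2 * L * \<eta>" for a
    by (simp add: W_def)
  finally show ?thesis .
qed

text \<open>The count is \<open>K * (K + 1) / 2\<close>. Bounding it by the square lets the sample
  complexity follow by squaring the iteration bound.\<close>

lemma sample_count_le: "sample_count K \<le> K\<^sup>2"
  unfolding sample_count_def batch_size_def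
  by (induction K) (simp_all add: power2_eq_square)

text \<open>\<open>rate\<close> carries the factor \<open>c - 1\<close> and the conclusion
  \<open>c\<close>: the difference \<open>Q / \<epsilon>\<close> pays for the ceiling once it
  exceeds 1. In that case the witness also passes the threshold \<open>b\<close>, because it is at
  least \<open>c - 1\<close>. A least index is bounded by any witness.\<close>

lemma iteration_complexity:
  fixes e :: "nat \<Rightarrow> real"
  assumes rate: "\<And>K. b < real K \<Longrightarrow> e K \<le> (c - 1) * Q / real K" and triv: "\<And>K. e K \<le> Q"
    and c: "b < c - 1" "1 \<le> c" and \<epsilon>: "0 < \<epsilon>" and Q: "0 \<le> Q" and K: "K = (LEAST K. e K \<le> \<epsilon>)"
  shows "e K \<le> \<epsilon>" "real K \<le> c * (Q / \<epsilon>)"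
proof -
  \<comment> \<open>If \<open>Q \<le> \<epsilon>\<close>, rounding up would exceed the bound, but then no step is needed at all.\<close>
  have "\<exists>K0. e K0 \<le> \<epsilon> \<and> real K0 \<le> c * (Q / \<epsilon>)"
  proof (cases "Q \<le> \<epsilon>")
    case True
    then show ?thesis using triv[of 0] c Q \<epsilon> by (intro exI[of _ 0]) auto
  next
    case False
    define K0 where "K0 = nat \<lceil>(c - 1) * (Q / \<epsilon>)\<rceil>"
    have Q1: "1 < Q / \<epsilon>" using False \<epsilon> by simp
    have nn: "0 \<le> (c - 1) * (Q / \<epsilon>)" using c Q \<epsilon> by simp
    then have ge: "(c - 1) * (Q / \<epsilon>) \<le> real K0" and lt: "real K0 < (c - 1) * (Q / \<epsilon>) + 1"
      unfolding K0_def using ceiling_correct[of "(c - 1) * (Q / \<epsilon>)"] by linarith+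
    have "c - 1 \<le> (c - 1) * (Q / \<epsilon>)" using mult_left_mono[of 1 "Q / \<epsilon>" "c - 1"] Q1 c by simp
    then have b: "b < real K0" using c ge by linarith
    have "e K0 \<le> (c - 1) * Q / real K0" by (rule rate[OF b])
    also have "\<dots> \<le> \<epsilon>"
    \<comment> \<open>The threshold \<open>b\<close> may be negative here, so \<open>K0 = 0\<close>
      is possible; the quotient is then 0 by convention.\<close>
    proof (cases "K0 = 0")
      case False
      then show ?thesis using ge \<epsilon> by (simp add: field_simps)
    qed (use \<epsilon> in simp)
    finally have "e K0 \<le> \<epsilon>" .
    moreover have "(c - 1) * (Q / \<epsilon>) = c * (Q / \<epsilon>) - Q / \<epsilon>" by (simp only: left_diff_distrib mult_1_left)
    then have "real K0 \<le> c * (Q / \<epsilon>)" using lt Q1 by linarith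
    ultimately show ?thesis by blast
  qed
  then obtain K0 where K0: "e K0 \<le> \<epsilon>" "real K0 \<le> c * (Q / \<epsilon>)" by blast
  show "e K \<le> \<epsilon>" unfolding K by (rule LeastI[of "\<lambda>K. e K \<le> \<epsilon>", OF K0(1)])
  have "K \<le> K0" unfolding K by (rule Least_le[of "\<lambda>K. e K \<le> \<epsilon>", OF K0(1)])
  then show "real K \<le> c * (Q / \<epsilon>)" using K0(2) by linarith
qed

theorem corollary2:
  fixes M :: "'w measure" and P :: "'s measure"
    and X :: "(real ^ 'n) set" and Y :: "(real ^ 'm) set"
    and f :: "real ^ 'n \<Rightarrow> real ^ 'm \<Rightarrow> 'w \<Rightarrow> real"
    and G :: "real ^ 'n \<Rightarrow> real ^ 'm \<Rightarrow> 'w \<Rightarrow> real ^ 'm"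
    and F :: "real ^ 'n \<Rightarrow> real ^ 'm \<Rightarrow> real ^ 'm"
    and y :: "real ^ 'n \<Rightarrow> real ^ 'm"
    and fimp :: "real ^ 'n \<Rightarrow> real"
    and L0w Ltw :: "'w \<Rightarrow> real"
    and fstar L0 \<eta>0 \<eta> \<gamma> lam \<mu>F LF :: real
    and v :: "nat \<Rightarrow> nat \<Rightarrow> 's \<Rightarrow> real ^ 'n"
    and w :: "nat \<Rightarrow> nat \<Rightarrow> 's \<Rightarrow> 'w"
    and R :: "nat \<Rightarrow> 's \<Rightarrow> nat"
    and x0 :: "real ^ 'n"
    and x :: "nat \<Rightarrow> 's \<Rightarrow> real ^ 'n"
  \<comment> \<open>the problem; \<open>M\<close> is the law of \<open>\<omega>\<close>\<close>
  assumes "prob_space M"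
    and F_def: "F = (\<lambda>x y. LINT \<omega>|M. G x y \<omega>)"
    and y_def: "y = (\<lambda>x. VI_sol Y (F x))"
    and fimp_def: "fimp = (\<lambda>x. LINT \<omega>|M. f x (y x) \<omega>)"
    and fstar_def: "fstar = (INF x\<in>X. fimp x)"
    and integrable_G: "\<And>x y. x \<in> X + cball 0 \<eta>0 \<Longrightarrow> y \<in> Y \<Longrightarrow> integrable M (G x y)"
    and integrable_f: "\<And>x. x \<in> X + cball 0 \<eta>0 \<Longrightarrow> integrable M (f x (y x))"
  \<comment> \<open>Assumption (A1)\<close>
    and "0 < \<eta>0"
    and A1_imp: "\<And>\<omega>. \<omega> \<in> space M \<Longrightarrow> (L0w \<omega>)-lipschitz_on (X + cball 0 \<eta>0) (\<lambda>x. f x (y x) \<omega>)"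
    and A1_L0w: "L0w \<in> borel_measurable M" "integrable M (\<lambda>\<omega>. (L0w \<omega>)\<^sup>2)"
    and A1_L0: "L0 = sqrt (LINT \<omega>|M. (L0w \<omega>)\<^sup>2)"
    and A1_y: "\<And>x \<omega>. x \<in> X + cball 0 \<eta>0 \<Longrightarrow> \<omega> \<in> space M \<Longrightarrow>
                 (Ltw \<omega>)-lipschitz_on Y (\<lambda>y. f x y \<omega>)"
    and A1_Ltw: "Ltw \<in> borel_measurable M" "integrable M (\<lambda>\<omega>. (Ltw \<omega>)\<^sup>2)"
    and \<eta>: "0 < \<eta>" "\<eta> \<le> \<eta>0"
  \<comment> \<open>Assumption (A2)\<close>
    and A2_X: "X \<noteq> {}" "closed X" "bounded X" "convex X"
    and A2_Y: "Y \<noteq> {}" "closed Y" "bounded Y" "convex Y"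
  \<comment> \<open>Assumption (A3)\<close>
    and A3_mono: "\<And>x. x \<in> X + cball 0 \<eta>0 \<Longrightarrow> strongly_monotone_on \<mu>F Y (F x)"
    and A3_lip: "\<And>x. x \<in> X + cball 0 \<eta>0 \<Longrightarrow> LF-lipschitz_on Y (F x)"
  \<comment> \<open>Assumption (U')\<close>
    and "prob_space P"
    and v_range: "\<And>k j s. (k, j) \<in> sample_index \<Longrightarrow> s \<in> space P \<Longrightarrow> v k j s \<in> sphere 0 \<eta>"
    and v_distr: "\<And>k j. (k, j) \<in> sample_index \<Longrightarrow> distr P borel (v k j) = uniform_sphere \<eta>"
    and w_distr: "\<And>k j. (k, j) \<in> sample_index \<Longrightarrow> distr P M (w k j) = M"
    and v_w_indep: "\<And>k j. (k, j) \<in> sample_index \<Longrightarrow> indep_rv P borel (v k j) M (w k j)"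
    and indep: "prob_space.indep_vars P (\<lambda>_. borel \<Otimes>\<^sub>M M)
                  (\<lambda>(k, j) s. (v k j s, w k j s)) sample_index"
  \<comment> \<open>the scheme\<close>
    and "x0 \<in> X" and "0 < \<gamma>"
    and x_0: "\<And>s. s \<in> space P \<Longrightarrow> x 0 s = x0"
    and x_Suc: "\<And>k s. s \<in> space P \<Longrightarrow>
          x (Suc k) s = closest_point X (x k s - \<gamma> *\<^sub>R ((1 / real (batch_size k)) *\<^sub>R
            (\<Sum>j = 1..batch_size k. zo_gradient (\<lambda>z. f z (y z)) \<eta> (x k s) (v k j s) (w k j s))))"
    and lam: "0 < lam" "lam < 1"
    and R_distr: "\<And>K. distr P (count_space UNIV) (R K) =
          measure_pmf (pmf_of_set {nat \<lceil>lam * real K\<rceil>..K})"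
    and R_indep: "\<And>K. indep_rv P (count_space UNIV) (R K)
          (PiM sample_index (\<lambda>_. borel \<Otimes>\<^sub>M M))
          (\<lambda>s. \<lambda>(k, j)\<in>sample_index. (v k j s, w k j s))"
  shows "(\<forall>K l. \<gamma> < \<eta> / (real CARD('n) * L0) \<and> l = nat \<lceil>lam * real K\<rceil> \<and> real K > 2 / (1 - lam) \<longrightarrow>
      (LINT s|P. (norm (residual X \<eta>0 fimp \<eta> (1 / \<gamma>) (x (R K s) s)))\<^sup>2) \<le>
        (real CARD('n)^2 * L0^2 * \<gamma> * (0.5 - ln lam) * (1 - real CARD('n) * L0 * \<gamma> / (2 * \<eta>))
           + (LINT s|P. fimp (x l s)) - fstar + 2 * L0 * \<eta>)
        / ((1 - real CARD('n) * L0 * \<gamma> / \<eta>) * (\<gamma> / 4) * (1 - lam) * real K)) \<and>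
    (\<forall>\<epsilon> \<Delta> K\<epsilon>. \<gamma> = \<eta> / (2 * real CARD('n) * L0) \<and> \<eta> = 1 / L0 \<and> 0 < \<epsilon> \<and>
        (\<forall>z\<in>X. fimp z - fstar \<le> \<Delta>) \<and>
        K\<epsilon> = (LEAST K. (LINT s|P. (norm (residual X \<eta>0 fimp \<eta> (1 / \<gamma>) (x (R K s) s)))\<^sup>2) \<le> \<epsilon>) \<longrightarrow>
      (LINT s|P. (norm (residual X \<eta>0 fimp \<eta> (1 / \<gamma>) (x (R K\<epsilon> s) s)))\<^sup>2) \<le> \<epsilon> \<and>
      real K\<epsilon> \<le> hidden_factor lam \<Delta> * (real CARD('n)^2 * L0^2 / \<epsilon>) \<and>
      real (sample_count K\<epsilon>) \<le> (hidden_factor lam \<Delta>)\<^sup>2 * (real CARD('n)^4 * L0^4 / \<epsilon>^2))"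
proof -
  interpret M: prob_space M by fact
  interpret P: prob_space P by fact
  define n where "n = real CARD('n)"
  have n: "1 \<le> n" unfolding n_def using zero_less_card_finite[where 'a = 'n] by linarith
  define S where "S = X + cball (0 :: real^'n) \<eta>0"
  have S_sums: "S = {a + b |a b. a \<in> X \<and> b \<in> cball 0 \<eta>0}" unfolding S_def set_plus_def by blast
  have "compact X" using A2_X by (simp add: compact_eq_bounded_closed)
  \<comment> \<open>A sum of closed sets can fail to be closed; compactness of \<open>X\<close>
    secures closedness of \<open>S\<close>, on which the projection \<open>p\<close> relies.\<close>
  then have "compact S" unfolding S_sums by (intro compact_sums compact_cball)
  have "convex S" unfolding S_def by (intro convex_set_plus A2_X convex_cball)
  have X_S: "a + b \<in> S" if "a \<in> X" "norm b \<le> \<eta>0" for a b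
    unfolding S_def using that by (intro set_plus_intro) auto
  have X_sub: "X \<subseteq> S" using X_S[of _ 0] \<open>0 < \<eta>0\<close> by auto
  have S: "convex S" "closed S" "S \<noteq> {}"
    using \<open>compact S\<close> \<open>convex S\<close> X_sub A2_X(1) by (auto intro: compact_imp_closed)
  define p where "p = closest_point S"
  have p_S: "p z \<in> S" and p_id: "z \<in> S \<Longrightarrow> p z = z" for z
    using S by (auto simp: p_def closest_point_in_set closest_point_self)
  \<comment> \<open>The sampled objective is controlled on \<open>S\<close> only; composing it with the projection onto \<open>S\<close>
    extends it to the whole space without increasing its Lipschitz constants.\<close>
  define H where "H z = f (p z) (y (p z))" for z
  have H_eq: "H z = f z (y z)" if "z \<in> S" for z using p_id[OF that] by (simp add: H_def)
  define \<xi> where "\<xi> i s = (case i of (k, j) \<Rightarrow> (v k j s, w k j s))" for i s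
  interpret zo_oracle M H L0w L0 \<eta>
  proof unfold_locales
    show "integrable M (H z)" for z
      unfolding H_def using p_S[of z] by (intro integrable_f) (simp add: S_def)
    show "(L0w \<omega>)-lipschitz_on UNIV (\<lambda>z. H z \<omega>)" if "\<omega> \<in> space M" for \<omega>
    proof (rule lipschitz_onI)
      have lip: "(L0w \<omega>)-lipschitz_on S (\<lambda>x. f x (y x) \<omega>)" using A1_imp[OF that] by (simp add: S_def)
      then show nonneg: "0 \<le> L0w \<omega>" by (rule lipschitz_on_nonneg)
      show "dist (H a \<omega>) (H b \<omega>) \<le> L0w \<omega> * dist a b" for a b
      proof -
        have "dist (H a \<omega>) (H b \<omega>) \<le> L0w \<omega> * dist (p a) (p b)"
          unfolding H_def using lipschitz_onD[OF lip p_S p_S] .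
        also have "\<dots> \<le> L0w \<omega> * dist a b"
          unfolding p_def by (intro mult_left_mono closest_point_lipschitz S nonneg)
        finally show ?thesis .
      qed
    qed
  qed (use A1_L0w A1_L0 \<eta> in auto)
  interpret zo_scheme M H L0w L0 \<eta> P X \<gamma> x0 \<xi>
  proof unfold_locales
    show "distr P (borel \<Otimes>\<^sub>M M) (\<xi> i) = sample_law" if "i \<in> sample_index" for i
    proof -
      obtain k j where i: "i = (k, j)" by (cases i)
      then have kj: "(k, j) \<in> sample_index" using that by simp
      have "distr P (borel \<Otimes>\<^sub>M M) (\<xi> i) = distr P borel (v k j) \<Otimes>\<^sub>M distr P M (w k j)"
        using v_w_indep[OF kj] by (simp add: indep_rv_def \<xi>_def[abs_def] i)
      then show ?thesis
        unfolding v_distr[OF kj] w_distr[OF kj] sample_law_def .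
    qed
    show "P.indep_vars (\<lambda>_. borel \<Otimes>\<^sub>M M) \<xi> sample_index"
      using indep unfolding \<xi>_def[abs_def] by (simp add: case_prod_unfold)
  qed (use A2_X \<open>x0 \<in> X\<close> \<open>0 < \<gamma>\<close> in auto)
  have samples_eq: "samples = (\<lambda>s. \<lambda>(k, j)\<in>sample_index. (v k j s, w k j s))"
    by (intro ext) (auto simp: samples_def \<xi>_def restrict_def)
  have H_mean_eq: "H_mean z = fimp z" if "z \<in> S" for z
    unfolding H_mean_def fimp_def H_eq[OF that] ..
  \<comment> \<open>The actual run never leaves \<open>S\<close>: its iterates lie in
    \<open>X\<close> and its directions have norm \<open>\<eta> \<le> \<eta>0\<close>. So each
    oracle call sees the same values for \<open>f\<close> and for the extension
    \<open>H\<close>.\<close>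
  have x_eq: "x k s = xi k s" if s: "s \<in> space P" for k s
  proof (induction k)
    case 0
    then show ?case by (simp add: x_0[OF s] xi_def)
  next
    case (Suc k)
    have "(\<Sum>j = 1..batch_size k. zo_gradient (\<lambda>z. f z (y z)) \<eta> (xi k s) (v k j s) (w k j s)) =
        (\<Sum>j = 1..batch_size k. g (xi k s) (samples s (k, j)))"
    proof (rule sum.cong[OF refl])
      fix j assume "j \<in> {1..batch_size k}"
      then have kj: "(k, j) \<in> sample_index" by (rule in_sample_index)
      have "norm (v k j s) = \<eta>" using v_range[OF kj s] by simp
      then have "xi k s + v k j s \<in> S" "xi k s \<in> S"
        using X_S[OF xi_in_X] X_sub xi_in_X \<eta> by auto
      then show "zo_gradient (\<lambda>z. f z (y z)) \<eta> (xi k s) (v k j s) (w k j s) = g (xi k s) (samples s (k, j))"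
        using kj by (simp add: g_def zo_gradient_def H_eq samples_def \<xi>_def)
    qed
    then show ?case
      unfolding x_Suc[OF s] Suc.IH xi_Suc batch_gradient_def by simp
  qed
  \<comment> \<open>From a point of \<open>T\<close>, moving by at most \<eta> stays in
    \<open>S\<close>, so the two smoothed functions agree on \<open>T\<close>. The global gradient
    of one is therefore a gradient of the other relative to \<open>T\<close>, and the projection
    does not depend on which such gradient is chosen.\<close>
  have residual_eq: "(norm (residual X \<eta>0 fimp \<eta> (1 / \<gamma>) z))\<^sup>2 = stationarity z" if z: "z \<in> X" for z
  proof -
    define T where "T = X + cball (0 :: real^'n) (\<eta>0 - \<eta>)"
    have T: "convex T" unfolding T_def using A2_X(4) by (intro convex_set_plus) auto
    have X_T: "X \<subseteq> T"
    proof
      fix a assume "a \<in> X"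
      then have "a + 0 \<in> T" unfolding T_def using \<eta> by (intro set_plus_intro) auto
      then show "a \<in> T" by simp
    qed
    have smooth_eq: "smoothing \<eta> fimp a = smoothing \<eta> H_mean a" if a_T: "a \<in> T" for a
    proof -
      obtain b c where a: "a = b + c" "b \<in> X" "norm c \<le> \<eta>0 - \<eta>"
        using a_T unfolding T_def set_plus_def by auto
      have "fimp (a + \<eta> *\<^sub>R u) = H_mean (a + \<eta> *\<^sub>R u)" if "u \<in> cball 0 1" for u
      proof -
        have "norm (c + \<eta> *\<^sub>R u) \<le> norm c + \<eta> * norm u"
          using norm_triangle_ineq[of c "\<eta> *\<^sub>R u"] \<eta> by simp
        also have "\<dots> \<le> (\<eta>0 - \<eta>) + \<eta> * 1"
          using a that \<eta> by (intro add_mono mult_left_mono) auto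
        finally have "b + (c + \<eta> *\<^sub>R u) \<in> S" by (intro X_S a) simp
        then show ?thesis using H_mean_eq a(1) by (simp add: add.assoc)
      qed
      then show ?thesis
        unfolding smoothing_def
        by (intro arg_cong2[where f = "(/)"] set_lebesgue_integral_cong refl) auto
    qed
    have "(smoothing \<eta> fimp has_derivative (\<lambda>d. grad z \<bullet> d)) (at z within T)"
    proof (rule has_derivative_transform)
      show "(smoothing \<eta> H_mean has_derivative (\<lambda>d. grad z \<bullet> d)) (at z within T)"
        using smoothing_has_derivative by (rule has_derivative_at_withinI)
    qed (use z X_T smooth_eq in auto)
    then have "closest_point X (z - \<gamma> *\<^sub>R grad_within T (smoothing \<eta> fimp) z) = closest_point X (z - \<gamma> *\<^sub>R grad z)"
      by (rule closest_point_gradient_step) (use A2_X X_T z T in auto)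
    then show ?thesis
      by (simp add: residual_def stationarity_def T_def)
  qed
  have loss_eq: "(LINT s|P. (norm (residual X \<eta>0 fimp \<eta> (1 / \<gamma>) (x (R K s) s)))\<^sup>2) =
      P.expectation (\<lambda>s. stationarity (xi (R K s) s))" for K
    by (intro Bochner_Integration.integral_cong refl) (simp add: x_eq residual_eq xi_in_X)
  have fimp_eq: "(LINT s|P. fimp (x l s)) = P.expectation (\<lambda>s. H_mean (xi l s))" for l
    using H_mean_eq X_sub xi_in_X
    by (intro Bochner_Integration.integral_cong refl) (auto simp: x_eq subset_eq)
  \<comment> \<open>A real infimum is a lower bound only if the set is bounded below; this comes
    from continuity of \<open>H_mean\<close> on the compact set \<open>X\<close>.\<close>
  have fstar_le: "fstar \<le> H_mean z" if "z \<in> X" for z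
  proof -
    have "compact (H_mean ` X)"
      using lipschitz_on_continuous_on[OF H_mean_lipschitz] \<open>compact X\<close>
      by (intro compact_continuous_image) (auto intro: continuous_on_subset)
    moreover have "H_mean ` X = fimp ` X"
      using H_mean_eq X_sub by (intro image_cong) auto
    ultimately have "bdd_below (fimp ` X)"
      using compact_imp_bounded bounded_imp_bdd_below by metis
    from cINF_lower[OF this that] show ?thesis
      unfolding fstar_def using that H_mean_eq[of z] X_sub by auto
  qed
  have bound: "(LINT s|P. (norm (residual X \<eta>0 fimp \<eta> (1 / \<gamma>) (x (R K s) s)))\<^sup>2) \<le>
        (real CARD('n)^2 * L0^2 * \<gamma> * (0.5 - ln lam) * (1 - real CARD('n) * L0 * \<gamma> / (2 * \<eta>))
           + (LINT s|P. fimp (x l s)) - fstar + 2 * L0 * \<eta>)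
        / ((1 - real CARD('n) * L0 * \<gamma> / \<eta>) * (\<gamma> / 4) * (1 - lam) * real K)"
    if step: "\<gamma> < \<eta> / (real CARD('n) * L0)" and l: "l = nat \<lceil>lam * real K\<rceil>" and K: "real K > 2 / (1 - lam)" for K l
  proof -
    have "0 < 2 / (1 - lam)" using lam by simp
    then have "0 < K" using K by (intro gr0I) auto
    from expected_stationarity_le[OF lam this l step fstar_le R_distr[of K, folded l] R_indep[of K, folded samples_eq]]
    show ?thesis unfolding loss_eq fimp_eq .
  qed
  have complexity: "(LINT s|P. (norm (residual X \<eta>0 fimp \<eta> (1 / \<gamma>) (x (R K\<epsilon> s) s)))\<^sup>2) \<le> \<epsilon> \<and>
      real K\<epsilon> \<le> hidden_factor lam \<Delta> * (real CARD('n)^2 * L0^2 / \<epsilon>) \<and>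
      real (sample_count K\<epsilon>) \<le> (hidden_factor lam \<Delta>)\<^sup>2 * (real CARD('n)^4 * L0^4 / \<epsilon>^2)"
    if \<gamma>: "\<gamma> = \<eta> / (2 * real CARD('n) * L0)" and \<eta>_eq: "\<eta> = 1 / L0" and \<epsilon>: "0 < \<epsilon>"
      and \<Delta>: "\<forall>z\<in>X. fimp z - fstar \<le> \<Delta>"
      and K\<epsilon>: "K\<epsilon> = (LEAST K. (LINT s|P. (norm (residual X \<eta>0 fimp \<eta> (1 / \<gamma>) (x (R K s) s)))\<^sup>2) \<le> \<epsilon>)"
    for \<epsilon> \<Delta> K\<epsilon>
  proof -
    define e where "e K = (LINT s|P. (norm (residual X \<eta>0 fimp \<eta> (1 / \<gamma>) (x (R K s) s)))\<^sup>2)" for K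
    define Q where "Q = n\<^sup>2 * L0\<^sup>2"
    define c where "c = hidden_factor lam \<Delta>"
    \<comment> \<open>At the prescribed \<gamma> and \<eta>, the noise term of the bound is
      \<open>n / 2 * (1 / 2 - ln lam) * (1 - 1 / 4)\<close>, that is, \<open>n * b\<close>.\<close>
    define b where "b = 3 / 8 * (1 / 2 - ln lam)"
    have L0: "0 < L0" using \<eta>(1) \<eta>_eq by simp
    have \<gamma>': "\<gamma> = 1 / (2 * n * L0\<^sup>2)" unfolding \<gamma> \<eta>_eq n_def by (simp add: power2_eq_square)
    have b: "3 / 16 \<le> b" using ln_le_zero_iff[of lam] lam by (simp add: b_def)
    have \<Delta>0: "0 \<le> \<Delta>"
      using bspec[OF \<Delta> \<open>x0 \<in> X\<close>] fstar_le[OF \<open>x0 \<in> X\<close>] H_mean_eq[of x0] X_sub \<open>x0 \<in> X\<close> by auto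
    have c1: "c - 1 = 16 / (1 - lam) * (b + \<Delta> + 2)" by (simp add: c_def hidden_factor_def b_def)
    have "16 / (1 - lam) * 2 \<le> 16 / (1 - lam) * (b + \<Delta> + 2)"
      using lam b \<Delta>0 by (intro mult_left_mono) auto
    moreover have "2 / (1 - lam) < 16 / (1 - lam) * 2" using lam by (simp add: field_simps)
    ultimately have c2: "2 / (1 - lam) < c - 1" unfolding c1 by linarith
    moreover have "0 < 2 / (1 - lam)" using lam by simp
    ultimately have c3: "1 \<le> c" by linarith
    have rate: "e K \<le> (c - 1) * Q / real K" if K: "2 / (1 - lam) < real K" for K
    proof -
      define l where "l = nat \<lceil>lam * real K\<rceil>"
      have Kpos: "0 < real K" using K \<open>0 < 2 / (1 - lam)\<close> by linarith
      \<comment> \<open>Bounding the gap over all of \<open>X\<close> removes the dependence of the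
        numerator on \<open>l\<close>, and thereby on \<open>K\<close>.\<close>
      have "P.expectation (\<lambda>s. H_mean (xi l s)) \<le> P.expectation (\<lambda>s. fstar + \<Delta>)"
      proof (intro integral_mono integrable_xi lipschitz_on_continuous_on[OF H_mean_lipschitz])
        show "H_mean (xi l s) \<le> fstar + \<Delta>" for s
          using bspec[OF \<Delta> xi_in_X[of l s]] H_mean_eq[of "xi l s"] X_sub xi_in_X[of l s] by auto
      qed simp
      then have W: "(LINT s|P. fimp (x l s)) - fstar \<le> \<Delta>"
        unfolding fimp_eq using P.prob_space by simp
      have half: "n * L0 * \<gamma> / \<eta> = 1 / 2" "n * L0 * \<gamma> / (2 * \<eta>) = 1 / 4" "n\<^sup>2 * L0\<^sup>2 * \<gamma> = n / 2" "L0 * \<eta> = 1"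
        using L0 n unfolding \<gamma>' \<eta>_eq by (simp_all add: field_simps power2_eq_square)
      have "\<gamma> < \<eta> / (real CARD('n) * L0)"
        unfolding \<gamma> using \<eta>(1) L0 by (intro divide_strict_left_mono) auto
      from bound[OF this l_def K]
      have "e K \<le> (n\<^sup>2 * L0\<^sup>2 * \<gamma> * (0.5 - ln lam) * (1 - n * L0 * \<gamma> / (2 * \<eta>))
           + (LINT s|P. fimp (x l s)) - fstar + 2 * (L0 * \<eta>))
        / ((1 - n * L0 * \<gamma> / \<eta>) * (\<gamma> / 4) * (1 - lam) * real K)"
        by (simp add: e_def n_def mult.assoc)
      also have "\<dots> = (n * b + ((LINT s|P. fimp (x l s)) - fstar) + 2) / (\<gamma> / 8 * (1 - lam) * real K)"
      proof -
        have num: "n / 2 * (0.5 - ln lam) * (1 - 1 / 4) = n * b" by (simp add: b_def field_simps)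
        show ?thesis unfolding half num by simp
      qed
      \<comment> \<open>Since \<open>n \<ge> 1\<close>, the terms without \<open>n\<close> may be
        multiplied by it. With \<open>8 / \<gamma> = 16 * n * L0\<^sup>2\<close> everything becomes
        a multiple of \<open>Q\<close>, and the 16 is the one in
        \<open>hidden_factor\<close>.\<close>
      also have "\<dots> \<le> (n * (b + \<Delta> + 2)) / (\<gamma> / 8 * (1 - lam) * real K)"
      proof (rule divide_right_mono)
        have "\<Delta> + 2 \<le> n * (\<Delta> + 2)" using mult_right_mono[OF n, of "\<Delta> + 2"] \<Delta>0 by simp
        then show "n * b + ((LINT s|P. fimp (x l s)) - fstar) + 2 \<le> n * (b + \<Delta> + 2)"
          using W by (simp add: algebra_simps)
      qed (use \<open>0 < \<gamma>\<close> lam in auto)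
      also have "\<dots> = (c - 1) * Q / real K"
        unfolding c1 Q_def \<gamma>' using n L0 lam Kpos by (simp add: field_simps power2_eq_square)
      finally show ?thesis .
    qed
    \<comment> \<open>This bound holds for every \<open>K\<close>, including 0 and the values below
      the threshold of \<open>rate\<close>.\<close>
    have triv: "e K \<le> Q" for K
    proof -
      have "e K \<le> P.expectation (\<lambda>s. Q)"
        unfolding e_def loss_eq
      proof (rule integral_mono')
        show "stationarity (xi (R K s) s) \<le> Q" for s
          using stationarity_le[OF xi_in_X] by (simp add: Q_def n_def)
      qed (auto simp: stationarity_nonneg Q_def)
      then show ?thesis using P.prob_space by simp
    qed
    have K\<epsilon>': "K\<epsilon> = (LEAST K. e K \<le> \<epsilon>)" unfolding K\<epsilon> e_def ..
    have Q: "0 \<le> Q" by (simp add: Q_def)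
    note complexity = iteration_complexity[OF rate triv c2 c3 \<epsilon> Q K\<epsilon>']
    have "real (sample_count K\<epsilon>) \<le> (real K\<epsilon>)\<^sup>2"
      using sample_count_le[of K\<epsilon>] by (metis of_nat_le_iff of_nat_power)
    also have "\<dots> \<le> (c * (Q / \<epsilon>))\<^sup>2" using complexity(2) by (intro power_mono) auto
    also have "\<dots> = c\<^sup>2 * (n ^ 4 * L0 ^ 4 / \<epsilon>\<^sup>2)"
      by (simp add: Q_def power_mult_distrib power_divide)
    finally show ?thesis
      using complexity unfolding e_def c_def Q_def n_def by simp
  qed
  show ?thesis using bound complexity by blast
qed

end
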